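(* Let $N\geq 1$ be an integer and let $f\in C^1(\mathbb{R})$. Then there is no nonconstant global minimizer $u$ of the equation $-\Delta u=f(u)$ in $\mathbb{R}^N$ such that $\lim_{|x|\to\infty}u(x)=u_\infty$ for some $u_\infty\in\mathbb{R}$.
   Context: Let $G:\mathbb{R}\to\mathbb{R}$ be a primitive of $-f$, i.e. $G'=-f$ (the choice of additive constant is immaterial for the definition below). For a bounded domain $\Omega\subset\mathbb{R}^N$, the energy functional is $$E_\Omega(u)=\int_\Omega\left(\tfrac12|\nabla u|^2+G(u)\right)dx .$$ A function $u\in C^1(\mathbb{R}^N)$ is called a global minimizer of $-\Delta u=f(u)$ in $\mathbb{R}^N$ if for every smooth bounded domain $\Omega\subset\mathbb{R}^N$ one has $E_\Omega(u)\leq E_\Omega(w)$ for every function $w\in C^{0,1}(\overline{\Omega})$ (Lipschitz on $\overline\Omega$) such that $w=u$ on $\partial\Omega$. *)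

theory Defs
  imports "HOL-Analysis.Analysis"
begin

(* Only meaningful where u is differentiable.  For Lipschitz u this holds almost everywhere
   (Rademacher), so the arbitrary value at the remaining points does not affect integrals
   with respect to the complete measure lebesgue. *)
definition gradient :: "('a::euclidean_space \<Rightarrow> real) \<Rightarrow> 'a \<Rightarrow> 'a" where
  "gradient u x = (THE D. GDERIV u x :> D)"

definition C1_function :: "('a::euclidean_space \<Rightarrow> real) \<Rightarrow> bool" where
  "C1_function u \<longleftrightarrow> (\<forall>x. u differentiable (at x)) \<and> continuous_on UNIV (gradient u)"

(* C^k on an open set: all directional derivatives are C^(k-1). *)
fun Ck_on :: "nat \<Rightarrow> 'a::euclidean_space set \<Rightarrow> ('a \<Rightarrow> real) \<Rightarrow> bool" where
  "Ck_on 0 U h \<longleftrightarrow> continuous_on U h"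
| "Ck_on (Suc k) U h \<longleftrightarrow>
     (\<forall>x\<in>U. h differentiable (at x)) \<and>
     (\<forall>v. Ck_on k U (\<lambda>x. frechet_derivative h (at x) v))"

(* Each boundary point has a neighbourhood in which the domain is a strict sublevel set of a
   C^\<infinity> function without critical points; by the implicit function theorem, the domain lies
   locally on one side of a C^\<infinity> hypersurface. *)
definition smooth_bounded_domain :: "'a::euclidean_space set \<Rightarrow> bool" where
  "smooth_bounded_domain \<Omega> \<longleftrightarrow>
     open \<Omega> \<and> connected \<Omega> \<and> \<Omega> \<noteq> {} \<and> bounded \<Omega> \<and>
     (\<forall>p\<in>frontier \<Omega>. \<exists>U h. open U \<and> p \<in> U \<and> (\<forall>k. Ck_on k U h) \<and>
        (\<forall>x\<in>U. gradient h x \<noteq> 0) \<and>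
        \<Omega> \<inter> U = {x\<in>U. h x < 0} \<and> frontier \<Omega> \<inter> U = {x\<in>U. h x = 0})"

definition energy :: "(real \<Rightarrow> real) \<Rightarrow> 'a::euclidean_space set \<Rightarrow> ('a \<Rightarrow> real) \<Rightarrow> real" where
  "energy G \<Omega> u = (LINT x:\<Omega>|lebesgue. (1/2) * (norm (gradient u x))\<^sup>2 + G (u x))"

(* Competitors are total functions, but as \<Omega> is open only their values on closure \<Omega> matter.
   The choice of primitive G is immaterial: two of them differ by a constant, which changes
   both energies by the same amount. *)
definition global_minimizer :: "(real \<Rightarrow> real) \<Rightarrow> ('a::euclidean_space \<Rightarrow> real) \<Rightarrow> bool" where
  "global_minimizer f u \<longleftrightarrow> C1_function u \<and>
     (\<exists>G. (\<forall>t. (G has_real_derivative - f t) (at t)) \<and>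
        (\<forall>\<Omega> w. smooth_bounded_domain \<Omega> \<longrightarrow> (\<exists>L. L-lipschitz_on (closure \<Omega>) w) \<longrightarrow>
           (\<forall>x\<in>frontier \<Omega>. w x = u x) \<longrightarrow> energy G \<Omega> u \<le> energy G \<Omega> w))"

end

theory Submission
  imports Defs
begin

text \<open>Let a be the limit of u and suppose M = max u > a. Balls suffice as domains, and truncations
  min u \<rho> and max u \<rho> with \<rho> of class C^1 suffice as competitors; these are differentiable almost
  everywhere by a Fubini argument, so Rademacher's theorem is not needed. Truncating at the level
  \<rho> = s shows that no s in (a, M) minimises G over [s, M], whence G M \<le> G s for all s in [a, M].
  Lifting u to a constant c > M on large balls shows G a \<le> G c. Hence M is a local minimum of G,
  so f M = 0, and the strong maximum principle, proved by taking Hopf's barrier for \<rho>, makes u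
  constantly M, contradicting the limit. The case min u < a follows by reflection.\<close>

section \<open>Gradients and C1 functions\<close>

text \<open>Pointwise information comes from energy inequalities instead: if a continuous
  nonnegative function has integral at most 0 over an open set, it vanishes there. For truncation at
  s this function is |grad u|^2/2 + G(u) - G(s), nonnegative if s minimises G over [s, M]; then u
  would be locally constant above s and could not come down to its limit. In the maximum principle
  all second derivatives fall on the smooth barrier \<rho>: convexity of |p|^2/2 leaves the cross
  term grad(u - \<rho>) . grad \<rho>, and integration by parts trades it for -(u - \<rho>) Delta
  \<rho>. Differentiability of f at M, where f vanishes, gives |f(t)| \<le> C |t - M| nearby, a term
  that a steep enough barrier dominates.\<close>

lemma gradient_eqI:
  assumes "GDERIV h x :> D"
  shows "gradient h x = D"
  unfolding gradient_def
proof (rule the_equality)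
  show "GDERIV h x :> D" by fact
  fix E assume "GDERIV h x :> E"
  then have "(\<lambda>v. v \<bullet> E) = (\<lambda>v. v \<bullet> D)"
    using assms unfolding gderiv_def by (rule has_derivative_unique)
  then have "(E - D) \<bullet> E = (E - D) \<bullet> D" by (rule fun_cong)
  then have "(E - D) \<bullet> (E - D) = 0" by (simp add: inner_diff_right)
  then show "E = D" by simp
qed

lemma differentiable_imp_GDERIV:
  fixes h :: "'a::euclidean_space \<Rightarrow> real"
  assumes "h differentiable (at x)"
  shows "GDERIV h x :> gradient h x"
proof -
  obtain L where L: "(h has_derivative L) (at x)"
    using assms by (auto simp: differentiable_def)
  then interpret bounded_linear L by (rule has_derivative_bounded_linear)
  have "L = (\<lambda>v. v \<bullet> (\<Sum>b\<in>Basis. L b *\<^sub>R b))"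
  proof
    fix v
    have "L v = L (\<Sum>b\<in>Basis. (v \<bullet> b) *\<^sub>R b)" by (simp add: euclidean_representation)
    also have "\<dots> = (\<Sum>b\<in>Basis. (v \<bullet> b) * L b)" by (simp add: sum scaleR)
    finally show "L v = v \<bullet> (\<Sum>b\<in>Basis. L b *\<^sub>R b)"
      by (simp add: inner_sum_right mult.commute)
  qed
  with L have "GDERIV h x :> (\<Sum>b\<in>Basis. L b *\<^sub>R b)" by (simp add: gderiv_def)
  then show ?thesis by (simp add: gradient_eqI)
qed

lemma C1_function_GDERIV: "C1_function h \<Longrightarrow> GDERIV h x :> gradient h x"
  by (simp add: C1_function_def differentiable_imp_GDERIV)

lemma C1_function_continuous_gradient: "C1_function h \<Longrightarrow> continuous_on A (gradient h)"
  using continuous_on_subset by (auto simp: C1_function_def)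

lemma C1_function_continuous: "C1_function h \<Longrightarrow> continuous_on A h"
  by (auto simp: C1_function_def intro!: differentiable_imp_continuous_on
      differentiable_at_imp_differentiable_on)

lemma
  assumes "\<And>x. GDERIV h x :> D x" and "continuous_on UNIV D"
  shows C1_functionI: "C1_function h" and gradient_eq_fun: "gradient h = D"
proof -
  show "gradient h = D" using assms(1) gradient_eqI by blast
  then show "C1_function h"
    using assms unfolding C1_function_def gderiv_def differentiable_def by blast
qed

lemma C1_function_diff:
  assumes "C1_function g" "C1_function h"
  shows "C1_function (\<lambda>x. g x - h x)" "gradient (\<lambda>x. g x - h x) = (\<lambda>x. gradient g x - gradient h x)"
proof -
  have "\<And>x. GDERIV (\<lambda>x. g x - h x) x :> gradient g x - gradient h x"
    using assms by (intro GDERIV_diff C1_function_GDERIV)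
  moreover have "continuous_on UNIV (\<lambda>x. gradient g x - gradient h x)"
    using assms by (intro continuous_intros C1_function_continuous_gradient)
  ultimately show "C1_function (\<lambda>x. g x - h x)"
      "gradient (\<lambda>x. g x - h x) = (\<lambda>x. gradient g x - gradient h x)"
    by (rule C1_functionI gradient_eq_fun; simp)+
qed

text \<open>Where \<open>w\<close> is not differentiable, both gradients are \<open>THE\<close>
  applied to the same everywhere false predicate, hence the same default vector. There the vectors
  cannot be shown to be opposite, so only the norms are compared; this is all that
  \<open>energy\<close> sees.\<close>

lemma norm_gradient_uminus: "norm (gradient (\<lambda>x. - w x) x) = norm (gradient w x)"
proof -
  have iff: "(GDERIV (\<lambda>x. - w x) x :> D) \<longleftrightarrow> (GDERIV w x :> - D)" for D
    using GDERIV_minus[of w x "- D"] GDERIV_minus[of "\<lambda>x. - w x" x D] by auto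
  show ?thesis
  proof (cases "\<exists>D. GDERIV w x :> D")
    case True
    then obtain D where D: "GDERIV w x :> D" ..
    then have "GDERIV (\<lambda>x. - w x) x :> - D" by (rule GDERIV_minus)
    with D show ?thesis by (simp add: gradient_eqI)
  next
    case False
    then have "(\<lambda>D. GDERIV w x :> - D) = (\<lambda>D. GDERIV w x :> D)" by auto
    then show ?thesis unfolding gradient_def iff by metis
  qed
qed

lemma C1_function_uminus:
  assumes "C1_function h"
  shows "C1_function (\<lambda>x. - h x)"
proof -
  have "GDERIV (\<lambda>x. - h x) x :> - gradient h x" for x
    using assms by (intro GDERIV_minus C1_function_GDERIV)
  moreover have "continuous_on UNIV (\<lambda>x. - gradient h x)"
    using assms by (intro continuous_intros C1_function_continuous_gradient)
  ultimately show ?thesis by (rule C1_functionI)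
qed

lemma GDERIV_at_local_max:
  fixes h :: "'a::euclidean_space \<Rightarrow> real"
  assumes "GDERIV h x :> D" "open U" "x \<in> U" "\<And>y. y \<in> U \<Longrightarrow> h y \<le> h x"
  shows "D = 0"
proof -
  have "(\<lambda>v. v \<bullet> D) = (\<lambda>v. 0)"
    using assms by (intro differential_zero_maxmin[of x U h]) (auto simp: gderiv_def)
  then have "D \<bullet> D = 0" by (rule fun_cong)
  then show ?thesis by simp
qed

lemma GDERIV_along_line:
  assumes "GDERIV g (x + t *\<^sub>R e) :> D"
  shows "((\<lambda>s. g (x + s *\<^sub>R e)) has_real_derivative D \<bullet> e) (at t)"
proof -
  have "((\<lambda>s. g (x + s *\<^sub>R e)) has_derivative (\<lambda>s. (s *\<^sub>R e) \<bullet> D)) (at t)"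
    by (rule has_derivative_compose[of "\<lambda>s. x + s *\<^sub>R e" "\<lambda>s. s *\<^sub>R e" t UNIV g])
      (use assms in \<open>auto intro!: derivative_eq_intros simp: gderiv_def\<close>)
  then show ?thesis
    unfolding has_field_derivative_def
    by (rule has_derivative_eq_rhs) (auto simp: inner_commute mult.commute)
qed

section \<open>Lipschitz bounds, and gradients on zero sets\<close>

lemma C1_function_lipschitz_on_cball:
  assumes "C1_function h"
  shows "\<exists>L. L-lipschitz_on (cball p r) h"
proof -
  have "compact (gradient h ` cball p r)"
    using assms by (intro compact_continuous_image C1_function_continuous_gradient) auto
  then have "bounded (gradient h ` cball p r)" by (rule compact_imp_bounded)
  then obtain B where "B > 0" "\<forall>y\<in>gradient h ` cball p r. norm y \<le> B"
    unfolding bounded_pos by blast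
  then have B: "B > 0" "\<And>x. x \<in> cball p r \<Longrightarrow> norm (gradient h x) \<le> B" by auto
  have "B-lipschitz_on (cball p r) h"
  proof (rule lipschitz_onI)
    fix x y assume "x \<in> cball p r" "y \<in> cball p r"
    then have "norm (h x - h y) \<le> B * norm (x - y)"
    proof (intro differentiable_bound[of "cball p r" h "\<lambda>x v. v \<bullet> gradient h x"])
      fix z assume z: "z \<in> cball p r"
      show "(h has_derivative (\<lambda>v. v \<bullet> gradient h z)) (at z within cball p r)"
        using C1_function_GDERIV[OF assms, of z] unfolding gderiv_def
        by (rule has_derivative_at_withinI)
      show "onorm (\<lambda>v. v \<bullet> gradient h z) \<le> B"
      proof (rule onorm_le)
        fix v
        have "norm (v \<bullet> gradient h z) \<le> norm v * norm (gradient h z)"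
          by (simp add: Cauchy_Schwarz_ineq2)
        also have "\<dots> \<le> norm v * B" by (intro mult_left_mono B z) simp
        finally show "norm (v \<bullet> gradient h z) \<le> B * norm v" by (simp add: mult.commute)
      qed
    qed auto
    then show "dist (h x) (h y) \<le> B * dist x y" by (simp add: dist_norm)
  qed (use B in simp)
  then show ?thesis ..
qed

lemma lipschitz_on_min:
  fixes g h :: "'a::metric_space \<Rightarrow> real"
  assumes "L-lipschitz_on S g" "K-lipschitz_on S h"
  shows "(max L K)-lipschitz_on S (\<lambda>x. min (g x) (h x))"
proof (rule lipschitz_onI)
  fix x y assume "x \<in> S" "y \<in> S"
  then have "\<bar>g x - g y\<bar> \<le> L * dist x y" "\<bar>h x - h y\<bar> \<le> K * dist x y"
    using assms by (auto simp: lipschitz_on_def dist_real_def)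
  moreover have "L * dist x y \<le> max L K * dist x y" "K * dist x y \<le> max L K * dist x y"
    by (auto intro: mult_right_mono)
  ultimately have "\<bar>g x - g y\<bar> \<le> max L K * dist x y" "\<bar>h x - h y\<bar> \<le> max L K * dist x y"
    by (auto intro: order_trans)
  then show "dist (min (g x) (h x)) (min (g y) (h y)) \<le> max L K * dist x y"
    unfolding dist_real_def by (auto simp: min_def abs_le_iff)
qed (use assms in \<open>auto simp: lipschitz_on_def\<close>)

text \<open>Translating by t e, Fubini reduces this to lines in direction e, on which
  the set is discrete, hence countable.\<close>

lemma null_sets_zero_nonsingular_direction:
  fixes g :: "'a::euclidean_space \<Rightarrow> real"
  assumes g: "C1_function g"
  shows "{x. g x = 0 \<and> gradient g x \<bullet> e \<noteq> 0} \<in> null_sets lborel" (is "?A \<in> _")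
proof -
  have [measurable]: "g \<in> borel_measurable borel" "gradient g \<in> borel_measurable borel"
    using g C1_function_continuous[of g UNIV] C1_function_continuous_gradient[of g UNIV]
    by (auto intro: borel_measurable_continuous_onI)
  have A[measurable]: "?A \<in> sets borel" by measurable
  have count: "countable {t. x + t *\<^sub>R e \<in> ?A}" (is "countable ?T") for x
  proof -
    define h h' where "h t = g (x + t *\<^sub>R e)" and "h' t = gradient g (x + t *\<^sub>R e) \<bullet> e" for t
    have der: "(h has_real_derivative h' t) (at t)" for t
      unfolding h_def h'_def by (intro GDERIV_along_line C1_function_GDERIV g)
    have cont: "continuous_on UNIV h'"
      unfolding h'_def by (intro continuous_intros continuous_on_compose2[OF
            C1_function_continuous_gradient[OF g, of UNIV]]) auto
    define D where "D = {t. h' t \<noteq> 0}"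
    have "open D" unfolding D_def using cont by (intro open_Collect_neq) auto
    \<comment> \<open>Zeros of \<open>h\<close> may accumulate where \<open>h'\<close> vanishes, so
      sparseness is claimed only relative to the open set \<open>D\<close>; it still yields
      countability because \<open>?T\<close> lies in \<open>D\<close>.\<close>
    moreover have "?T sparse_in D"
      unfolding sparse_in_eventually_iff[OF \<open>open D\<close>]
    proof
      fix y assume y: "y \<in> D"
      show "\<forall>\<^sub>F z in at y. z \<notin> ?T"
      proof (cases "h y = 0")
        case True
        have "((\<lambda>z. (h z - h y) / (z - y)) \<longlongrightarrow> h' y) (at y)"
          using der by (simp add: has_field_derivative_iff)
        then have "\<forall>\<^sub>F z in at y. (h z - h y) / (z - y) \<noteq> 0"
          using y by (intro tendsto_imp_eventually_ne) (auto simp: D_def)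
        then show ?thesis
          by eventually_elim (use True in \<open>auto simp: h_def\<close>)
      next
        case False
        have "(h \<longlongrightarrow> h y) (at y)" using der DERIV_isCont isCont_def by blast
        then have "\<forall>\<^sub>F z in at y. h z \<noteq> 0"
          using False by (rule tendsto_imp_eventually_ne)
        then show ?thesis by eventually_elim (auto simp: h_def)
      qed
    qed
    ultimately have "countable (D \<inter> ?T)" by (rule sparse_imp_countable)
    also have "D \<inter> ?T = ?T" by (auto simp: D_def h'_def)
    finally show ?thesis .
  qed
  have "AE x in lborel. AE t in (lborel :: real measure). x + t *\<^sub>R e \<notin> ?A"
    using AE_not_in[OF countable_imp_null_set_lborel[OF count]] by (auto intro!: AE_I2)
  then have "AE t in (lborel :: real measure). AE x in lborel. x + t *\<^sub>R e \<notin> ?A"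
  proof (subst lborel_pair.AE_commute)
    show "{p \<in> space (lborel \<Otimes>\<^sub>M lborel). snd p + fst p *\<^sub>R e \<notin> ?A} \<in> sets ((lborel :: real measure) \<Otimes>\<^sub>M lborel)"
    proof -
      have "(\<lambda>p::real \<times> 'a. snd p + fst p *\<^sub>R e) \<in> lborel \<Otimes>\<^sub>M lborel \<rightarrow>\<^sub>M borel"
        by measurable
      moreover have "- ?A \<in> sets borel" using A by (rule borel_comp)
      ultimately have "(\<lambda>p::real \<times> 'a. snd p + fst p *\<^sub>R e) -` (- ?A) \<inter> space (lborel \<Otimes>\<^sub>M lborel)
          \<in> sets ((lborel :: real measure) \<Otimes>\<^sub>M lborel)" by (rule measurable_sets)
      then show ?thesis
        by (rule back_subst[where P = "\<lambda>S. S \<in> sets _"]) auto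
    qed
  qed
  moreover have "\<not> (AE t in (lborel :: real measure). False)"
    by (simp add: AE_iff_measurable[OF _ refl])
  \<comment> \<open>A single good shift t is enough, since translation invariance of
    \<open>lborel\<close> then removes it. It exists because the real line is not a null
    set.\<close>
  ultimately have "\<exists>t. AE x in lborel. x + t *\<^sub>R e \<notin> ?A"
    using eventually_mono[of _ "ae_filter (lborel :: real measure)" "\<lambda>_. False"] by blast
  then obtain t where t: "AE x in lborel. x + t *\<^sub>R e \<notin> ?A" ..
  have "AE x in distr lborel borel ((+) (t *\<^sub>R e)). x \<notin> ?A"
    by (subst AE_distr_iff) (use t in \<open>auto simp: add.commute\<close>)
  then have "AE x in lborel. x \<notin> ?A" unfolding lborel_distr_plus .
  then show ?thesis using A by (subst (asm) AE_iff_null_sets[symmetric]) auto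
qed

text \<open>A nonzero gradient has a nonzero component along some basis vector, so the exceptional
  set is a finite union of null sets. Applied to u - \<rho>, this makes the gradients of u and
  \<rho> agree almost everywhere on the contact set.\<close>

lemma AE_gradient_zero_on_zero_set:
  fixes g :: "'a::euclidean_space \<Rightarrow> real"
  assumes "C1_function g"
  shows "AE x in lborel. g x = 0 \<longrightarrow> gradient g x = 0"
proof -
  have "AE x in lborel. \<forall>e\<in>Basis. x \<notin> {x. g x = 0 \<and> gradient g x \<bullet> e \<noteq> 0}"
    using assms by (intro AE_finite_allI AE_not_in null_sets_zero_nonsingular_direction) auto
  then show ?thesis
    by eventually_elim (auto simp: euclidean_eq_iff[where 'a='a])
qed

section \<open>Comparison with truncations\<close>

lemma Ck_on_affine: "Ck_on k U (\<lambda>x. x \<bullet> v + c)"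
proof (induction k arbitrary: v c)
  case 0
  show ?case by (auto intro!: continuous_intros)
next
  case (Suc k)
  have der: "((\<lambda>x. x \<bullet> v + c) has_derivative (\<lambda>w. w \<bullet> v)) (at x)" for x
    by (auto intro!: derivative_eq_intros)
  \<comment> \<open>The derivative is constant in \<open>x\<close>; writing it as an affine function
    with slope 0 lets the induction hypothesis apply.\<close>
  have "frechet_derivative (\<lambda>x. x \<bullet> v + c) (at x) w = x \<bullet> 0 + w \<bullet> v" for x w
    by (simp add: frechet_derivative_at[OF der, symmetric])
  moreover have "(\<lambda>x. x \<bullet> v + c) differentiable (at x)" for x
    using der by (rule differentiableI)
  ultimately show ?case using Suc[of 0] by simp
qed

text \<open>One defining function serves every boundary point: |x - p|^2 - r^2 on the complement of
  the centre, which is its only critical point. Its first derivatives are affine, which settles all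
  orders of smoothness.\<close>

lemma smooth_bounded_domain_ball:
  fixes p :: "'a::euclidean_space"
  assumes r: "0 < r"
  shows "smooth_bounded_domain (ball p r)"
proof -
  define h where "h x = (x - p) \<bullet> (x - p) - r\<^sup>2" for x
  have h: "h x = (dist p x)\<^sup>2 - r\<^sup>2" for x
    unfolding h_def dist_norm norm_minus_commute[of p x] power2_norm_eq_inner ..
  have der: "(h has_derivative (\<lambda>w. w \<bullet> (2 *\<^sub>R (x - p)))) (at x)" for x
    unfolding h_def by (auto intro!: derivative_eq_intros simp: inner_commute)
  have frech: "frechet_derivative h (at x) w = x \<bullet> (2 *\<^sub>R w) + - 2 * (p \<bullet> w)" for x w
    by (simp add: frechet_derivative_at[OF der, symmetric] inner_diff_right inner_commute)
  have "gradient h x = 2 *\<^sub>R (x - p)" for x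
    using der by (intro gradient_eqI) (simp add: gderiv_def)
  then have grad: "\<forall>x\<in>- {p}. gradient h x \<noteq> 0" by simp
  have Ck: "Ck_on k (- {p}) h" for k
  proof (cases k)
    case 0
    then show ?thesis by (auto simp: h_def intro!: continuous_intros)
  next
    case (Suc n)
    have "Ck_on n (- {p}) (\<lambda>x. x \<bullet> (2 *\<^sub>R w) + - 2 * (p \<bullet> w))" for w
      by (rule Ck_on_affine)
    then have "Ck_on n (- {p}) (\<lambda>x. frechet_derivative h (at x) w)" for w
      unfolding frech .
    then show ?thesis using Suc der by (auto simp: differentiable_def)
  qed
  have ineq: "h x < 0 \<longleftrightarrow> dist p x < r" "h x = 0 \<longleftrightarrow> dist p x = r" for x
    using r power_strict_mono[of "dist p x" r 2] power2_less_imp_less[of "dist p x" r]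
      power2_eq_iff_nonneg[of "dist p x" r] by (auto simp: h)
  have "\<exists>U h. open U \<and> q \<in> U \<and> (\<forall>k. Ck_on k U h) \<and> (\<forall>x\<in>U. gradient h x \<noteq> 0) \<and>
      ball p r \<inter> U = {x\<in>U. h x < 0} \<and> frontier (ball p r) \<inter> U = {x\<in>U. h x = 0}"
    if q: "q \<in> frontier (ball p r)" for q
  proof (intro exI conjI)
    show "open (- {p})" by (intro open_Compl closed_singleton)
    show "q \<in> - {p}" using q r by auto
    show "\<forall>k. Ck_on k (- {p}) h" using Ck by blast
    show "\<forall>x\<in>- {p}. gradient h x \<noteq> 0" by (fact grad)
    show "ball p r \<inter> - {p} = {x\<in>- {p}. h x < 0}" using ineq by auto
    show "frontier (ball p r) \<inter> - {p} = {x\<in>- {p}. h x = 0}" using ineq r by auto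
  qed
  then show ?thesis using r by (auto simp: smooth_bounded_domain_def)
qed

section \<open>Lebesgue integrals of functions known up to null sets\<close>

text \<open>The gradient of a truncation is unspecified on a null set, so nothing is known about
  measurability of \<open>f\<close> there. Completeness of \<open>lebesgue\<close> repairs this:
  every subset of a null set is measurable.\<close>

lemma measurable_lebesgue_AE_eq:
  fixes f g :: "'a::euclidean_space \<Rightarrow> real"
  assumes [measurable]: "g \<in> borel_measurable borel" and "AE x in lborel. f x = g x"
  shows "f \<in> borel_measurable lebesgue"
proof -
  obtain N where N: "N \<in> null_sets lborel" "{x. f x \<noteq> g x} \<subseteq> N"
    using assms(2) unfolding eventually_ae_filter by auto
  have [measurable]: "N \<in> sets borel" using N(1) by auto
  show ?thesis
  proof (rule measurableI)
    fix A :: "real set" assume [measurable]: "A \<in> sets borel"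
    have "f -` A \<inter> N \<in> null_sets lebesgue"
      by (rule null_sets_completion_subset[of _ N]) (use N in \<open>auto intro: null_sets_completionI\<close>)
    moreover have "g -` A \<inter> - N \<in> sets lborel" by measurable
    ultimately have "(g -` A \<inter> - N) \<union> (f -` A \<inter> N) \<in> sets lebesgue" by auto
    also have "(g -` A \<inter> - N) \<union> (f -` A \<inter> N) = f -` A \<inter> space lebesgue"
      using N(2) by (auto simp: subset_iff) metis+
    finally show "f -` A \<inter> space lebesgue \<in> sets lebesgue" .
  qed simp
qed

lemma set_integral_lebesgue_cong_AE:
  fixes f g :: "'a::euclidean_space \<Rightarrow> real"
  assumes "g \<in> borel_measurable borel" "S \<in> sets borel" "AE x in lborel. f x = g x"
  shows "(LINT x:S|lebesgue. f x) = (LINT x:S|lebesgue. g x)"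
proof (rule set_lebesgue_integral_cong_AE)
  show "f \<in> borel_measurable lebesgue" "g \<in> borel_measurable lebesgue" "S \<in> sets lebesgue"
    using assms measurable_lebesgue_AE_eq measurable_completion by auto
  show "AE x\<in>S in lebesgue. f x = g x"
    using assms(3) by (intro AE_completion) auto
qed

lemma continuous_set_integrable_lebesgue:
  fixes f :: "'a::euclidean_space \<Rightarrow> real"
  assumes f: "continuous_on UNIV f" and S: "S \<in> sets borel" "bounded S"
  shows "set_integrable lebesgue S f"
proof -
  obtain p r where pr: "S \<subseteq> cball p r" using S(2) unfolding bounded_subset_cball by blast
  have "set_integrable lborel (cball p r) f"
    unfolding set_integrable_def
    using f by (intro borel_integrable_compact) (auto intro: continuous_on_subset)
  then have "set_integrable lborel S f"
    by (rule set_integrable_subset) (use S pr in auto)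
  then show ?thesis unfolding set_integrable_def
    using borel_measurable_integrable by (subst integrable_completion) auto
qed

section \<open>Minimizers for a fixed potential, and their truncations\<close>

text \<open>This is what \<open>global_minimizer\<close> asserts for some primitive, with
  \<open>G\<close> as a parameter not tied to f. The comparison lemmas can then ask for continuity
  of \<open>G\<close> alone, and reflection becomes a change of \<open>G\<close>.\<close>

definition energy_minimizer :: "(real \<Rightarrow> real) \<Rightarrow> ('a::euclidean_space \<Rightarrow> real) \<Rightarrow> bool" where
  "energy_minimizer G u \<longleftrightarrow> C1_function u \<and>
     (\<forall>\<Omega> w. smooth_bounded_domain \<Omega> \<longrightarrow> (\<exists>L. L-lipschitz_on (closure \<Omega>) w) \<longrightarrow>
        (\<forall>x\<in>frontier \<Omega>. w x = u x) \<longrightarrow> energy G \<Omega> u \<le> energy G \<Omega> w)"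

text \<open>Competitors for -u are the negatives of competitors for u, and the energies agree under
  negation even where a competitor is not differentiable.\<close>

lemma energy_minimizer_reflect:
  fixes u :: "'a::euclidean_space \<Rightarrow> real"
  assumes "energy_minimizer G u"
  shows "energy_minimizer (\<lambda>t. G (- t)) (\<lambda>x. - u x)"
  unfolding energy_minimizer_def
proof (intro conjI allI impI)
  show "C1_function (\<lambda>x. - u x)"
    using assms by (intro C1_function_uminus) (simp add: energy_minimizer_def)
  fix \<Omega> and w :: "'a \<Rightarrow> real"
  assume "smooth_bounded_domain \<Omega>" and w: "\<exists>L. L-lipschitz_on (closure \<Omega>) w"
    and "\<forall>x\<in>frontier \<Omega>. w x = - u x"
  moreover from w have "\<exists>L. L-lipschitz_on (closure \<Omega>) (\<lambda>x. - w x)"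
    by (auto intro: lipschitz_on_minus)
  ultimately have "energy G \<Omega> u \<le> energy G \<Omega> (\<lambda>x. - w x)"
    using assms by (auto simp: energy_minimizer_def)
  then show "energy (\<lambda>t. G (- t)) \<Omega> (\<lambda>x. - u x) \<le> energy (\<lambda>t. G (- t)) \<Omega> w"
    by (simp add: energy_def norm_gradient_uminus)
qed

text \<open>Since both functions have the same value and gradient at \<open>x\<close>, the remainder
  of the minimum is at each point one of the two remainders, hence bounded by the sum of their
  norms.\<close>

lemma GDERIV_min_eq:
  fixes g h :: "'a::real_inner \<Rightarrow> real"
  assumes "GDERIV g x :> D" "GDERIV h x :> D" "g x = h x"
  shows "GDERIV (\<lambda>y. min (g y) (h y)) x :> D"
  unfolding gderiv_def has_derivative_iff_norm
proof
  show "bounded_linear (\<lambda>v. v \<bullet> D)" by (rule bounded_linear_inner_left)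
  let ?e = "\<lambda>f y. norm ((f y - f x) - (y - x) \<bullet> D) / norm (y - x)"
  have "((\<lambda>y. ?e g y + ?e h y) \<longlongrightarrow> 0 + 0) (at x)"
    using assms(1,2) unfolding gderiv_def has_derivative_iff_norm by (intro tendsto_add) auto
  then show "(?e (\<lambda>y. min (g y) (h y)) \<longlongrightarrow> 0) (at x)"
  proof (rule Lim_null_comparison[rotated, OF tendsto_eq_rhs])
    have "norm (?e (\<lambda>y. min (g y) (h y)) y) \<le> ?e g y + ?e h y" for y
      using assms(3) by (cases "g y \<le> h y") simp_all
    then show "\<forall>\<^sub>F y in at x. norm (?e (\<lambda>y. min (g y) (h y)) y) \<le> ?e g y + ?e h y"
      by simp
  qed simp
qed

text \<open>Off the contact set the minimum agrees locally with one of the functions. On it the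
  gradients are assumed equal, which for C^1 functions holds at almost every contact point.\<close>

lemma GDERIV_min:
  fixes u \<rho> :: "'a::euclidean_space \<Rightarrow> real"
  assumes u: "C1_function u" and \<rho>: "C1_function \<rho>" and eq: "u x = \<rho> x \<Longrightarrow> gradient u x = gradient \<rho> x"
  shows "GDERIV (\<lambda>y. min (u y) (\<rho> y)) x :> (if \<rho> x < u x then gradient \<rho> x else gradient u x)"
proof -
  note cont = C1_function_continuous[OF u, of UNIV] C1_function_continuous[OF \<rho>, of UNIV]
  consider "\<rho> x < u x" | "u x < \<rho> x" | "u x = \<rho> x" by linarith
  then show ?thesis
  proof cases
    case 1
    have "((\<lambda>y. min (u y) (\<rho> y)) has_derivative (\<lambda>v. v \<bullet> gradient \<rho> x)) (at x)"
      by (rule has_derivative_transform_within_open[of \<rho> _ _ _ "{y. \<rho> y < u y}"])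
        (use C1_function_GDERIV[OF \<rho>] 1 cont in \<open>auto simp: gderiv_def intro!: open_Collect_less\<close>)
    then show ?thesis using 1 by (simp add: gderiv_def)
  next
    case 2
    have "((\<lambda>y. min (u y) (\<rho> y)) has_derivative (\<lambda>v. v \<bullet> gradient u x)) (at x)"
      by (rule has_derivative_transform_within_open[of u _ _ _ "{y. u y < \<rho> y}"])
        (use C1_function_GDERIV[OF u] 2 cont in \<open>auto simp: gderiv_def intro!: open_Collect_less\<close>)
    then show ?thesis using 2 by (simp add: gderiv_def)
  next
    case 3
    then have "GDERIV \<rho> x :> gradient u x"
      using C1_function_GDERIV[OF \<rho>, of x] eq by simp
    from GDERIV_min_eq[OF C1_function_GDERIV[OF u] this 3] show ?thesis using 3 by simp
  qed
qed

abbreviation energy_density :: "(real \<Rightarrow> real) \<Rightarrow> ('a::euclidean_space \<Rightarrow> real) \<Rightarrow> 'a \<Rightarrow> real" where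
  "energy_density G u x \<equiv> (1/2) * (norm (gradient u x))\<^sup>2 + G (u x)"

lemma continuous_energy_density:
  assumes "continuous_on UNIV G" "C1_function u"
  shows "continuous_on A (energy_density G u)"
proof -
  have "continuous_on A (\<lambda>x. G (u x))"
    using assms C1_function_continuous by (intro continuous_on_compose2[OF assms(1)]) auto
  moreover have "continuous_on A (gradient u)"
    using assms by (intro C1_function_continuous_gradient)
  ultimately show ?thesis by (intro continuous_intros)
qed

text \<open>The competitor min u \<rho> equals u on the sphere and wherever u \<le> \<rho>, so the
  energies cancel outside the set \<rho> < u. What remains involves only the C^1 functions u and
  \<rho>.\<close>

lemma min_comparison:
  fixes u \<rho> :: "'a::euclidean_space \<Rightarrow> real"
  assumes min: "energy_minimizer G u" and G: "continuous_on UNIV G" and \<rho>: "C1_function \<rho>"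
    and r: "0 < r" and sphere: "\<And>x. x \<in> sphere p r \<Longrightarrow> u x \<le> \<rho> x"
  shows "(LINT x:{x \<in> ball p r. \<rho> x < u x}|lebesgue. energy_density G u x - energy_density G \<rho> x) \<le> 0"
proof -
  have u: "C1_function u" using min by (simp add: energy_minimizer_def)
  define w where "w x = min (u x) (\<rho> x)" for x
  define ew where "ew x = (if \<rho> x < u x then energy_density G \<rho> x else energy_density G u x)" for x
  let ?S = "{x \<in> ball p r. \<rho> x < u x}"
  note cont = C1_function_continuous[OF u, of UNIV] C1_function_continuous[OF \<rho>, of UNIV]
  note econt = continuous_energy_density[OF G u, of UNIV] continuous_energy_density[OF G \<rho>, of UNIV]
  have [measurable]: "u \<in> borel_measurable borel" "\<rho> \<in> borel_measurable borel"
    "energy_density G u \<in> borel_measurable borel" "energy_density G \<rho> \<in> borel_measurable borel"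
    using cont econt by (auto intro: borel_measurable_continuous_onI)
  have "open {x. \<rho> x < u x}" using cont by (intro open_Collect_less)
  then have "open (ball p r \<inter> {x. \<rho> x < u x})" by (intro open_Int open_ball)
  then have S: "open ?S" by (simp add: Collect_conj_eq ball_def)
  obtain L K where "L-lipschitz_on (cball p r) u" "K-lipschitz_on (cball p r) \<rho>"
    using C1_function_lipschitz_on_cball[OF u] C1_function_lipschitz_on_cball[OF \<rho>] by blast
  then have "(max L K)-lipschitz_on (cball p r) w" unfolding w_def by (rule lipschitz_on_min)
  then have "\<exists>L. L-lipschitz_on (closure (ball p r)) w" using r by auto
  moreover have "\<forall>x\<in>frontier (ball p r). w x = u x" using sphere r by (auto simp: w_def)
  ultimately have le: "energy G (ball p r) u \<le> energy G (ball p r) w"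
    using min smooth_bounded_domain_ball[OF r] unfolding energy_minimizer_def by blast
  \<comment> \<open>This supplies the contact hypothesis of \<open>GDERIV_min\<close> almost
    everywhere, and so the gradient of the competitor.\<close>
  have "AE x in lborel. u x - \<rho> x = 0 \<longrightarrow> gradient u x - gradient \<rho> x = 0"
    using AE_gradient_zero_on_zero_set[OF C1_function_diff(1)[OF u \<rho>]]
    by (simp add: C1_function_diff(2)[OF u \<rho>])
  then have "AE x in lborel. energy_density G w x = ew x"
  proof eventually_elim
    case (elim x)
    then have "gradient w x = (if \<rho> x < u x then gradient \<rho> x else gradient u x)"
      unfolding w_def by (intro gradient_eqI[OF GDERIV_min[OF u \<rho>]]) simp
    then show ?case by (auto simp: ew_def w_def)
  qed
  moreover have "ew \<in> borel_measurable borel" unfolding ew_def by measurable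
  ultimately have "energy G (ball p r) w = (LINT x:ball p r|lebesgue. ew x)"
    unfolding energy_def by (intro set_integral_lebesgue_cong_AE) auto
  moreover have iu: "set_integrable lebesgue (ball p r) (energy_density G u)"
    using econt by (auto intro: continuous_set_integrable_lebesgue)
  moreover have ie: "set_integrable lebesgue ?S (\<lambda>x. energy_density G u x - energy_density G \<rho> x)"
    using S by (intro continuous_set_integrable_lebesgue continuous_on_diff econt)
      (auto intro: bounded_subset[OF bounded_ball])
  moreover have split: "indicator (ball p r) x *\<^sub>R ew x = indicator (ball p r) x *\<^sub>R energy_density G u x -
      indicator ?S x *\<^sub>R (energy_density G u x - energy_density G \<rho> x)" for x
    by (auto simp: ew_def indicator_def)
  ultimately show ?thesis
    using le unfolding energy_def set_lebesgue_integral_def set_integrable_def split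
    by (simp add: Bochner_Integration.integral_diff del: real_scaleR_def)
qed

lemma max_comparison:
  fixes u \<rho> :: "'a::euclidean_space \<Rightarrow> real"
  assumes min: "energy_minimizer G u" and G: "continuous_on UNIV G" and \<rho>: "C1_function \<rho>"
    and r: "0 < r" and sphere: "\<And>x. x \<in> sphere p r \<Longrightarrow> \<rho> x \<le> u x"
  shows "(LINT x:{x \<in> ball p r. u x < \<rho> x}|lebesgue. energy_density G u x - energy_density G \<rho> x) \<le> 0"
proof -
  have "(LINT x:{x \<in> ball p r. - \<rho> x < - u x}|lebesgue.
      energy_density (\<lambda>t. G (- t)) (\<lambda>x. - u x) x - energy_density (\<lambda>t. G (- t)) (\<lambda>x. - \<rho> x) x) \<le> 0"
  proof (intro min_comparison energy_minimizer_reflect min C1_function_uminus \<rho> r)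
    show "continuous_on UNIV (\<lambda>t. G (- t))"
      by (intro continuous_on_compose2[OF G] continuous_intros) auto
  qed (use sphere in auto)
  then show ?thesis by (simp add: norm_gradient_uminus)
qed

section \<open>Integration by parts for positive parts\<close>

text \<open>The extension is F composed with the nearest-point projection onto the ball: the
  projection sends outside points to the sphere, where F vanishes. Being 1-Lipschitz, it preserves
  the constant L.\<close>

lemma lipschitz_on_extend_zero:
  fixes F :: "'a::euclidean_space \<Rightarrow> real"
  assumes F: "L-lipschitz_on (cball p r) F" and r: "0 < r" and zero: "\<And>x. x \<in> sphere p r \<Longrightarrow> F x = 0"
  shows "L-lipschitz_on UNIV (\<lambda>x. if x \<in> cball p r then F x else 0)"
proof -
  have "(if x \<in> cball p r then F x else 0) = F (closest_point (cball p r) x)" for x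
  proof (cases "x \<in> cball p r")
    case False
    have "affine hull (cball p r) = UNIV"
      using r by (intro affine_hull_nonempty_interior) auto
    then have "closest_point (cball p r) x \<in> rel_frontier (cball p r)"
      using False r rel_interior_subset[of "cball p r"] by (intro closest_point_in_rel_frontier) auto
    then have "closest_point (cball p r) x \<in> sphere p r" using r by simp
    then show ?thesis using False zero by simp
  qed (simp add: closest_point_self)
  moreover have "L-lipschitz_on UNIV (\<lambda>x. F (closest_point (cball p r) x))"
  proof (rule lipschitz_onI)
    fix x y
    have "dist (F (closest_point (cball p r) x)) (F (closest_point (cball p r) y))
        \<le> L * dist (closest_point (cball p r) x) (closest_point (cball p r) y)"
      using r by (intro lipschitz_onD[OF F] closest_point_in_set) auto
    also have "\<dots> \<le> L * dist x y"
      using r lipschitz_on_nonneg[OF F] by (intro mult_left_mono closest_point_lipschitz) auto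
    finally show "dist (F (closest_point (cball p r) x)) (F (closest_point (cball p r) y)) \<le> L * dist x y" .
  qed (use lipschitz_on_nonneg[OF F] in simp)
  ultimately show ?thesis by simp
qed

text \<open>The difference quotients of the zero extension of F have integral zero by translation
  invariance and are dominated by the Lipschitz constant.\<close>

lemma integral_directional_derivative_zero:
  fixes F D :: "'a::euclidean_space \<Rightarrow> real"
  assumes F: "L-lipschitz_on (cball p r) F" and r: "0 < r" and zero: "\<And>x. x \<in> sphere p r \<Longrightarrow> F x = 0"
    and D[measurable]: "D \<in> borel_measurable borel"
    and der: "AE x in lborel. x \<in> ball p r \<longrightarrow> ((\<lambda>t. F (x + t *\<^sub>R e)) has_real_derivative D x) (at 0)"
  shows "(LINT x:ball p r|lebesgue. D x) = 0"
proof -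
  define H where "H x = (if x \<in> cball p r then F x else 0)" for x
  have H: "L-lipschitz_on UNIV H"
    unfolding H_def using F r zero by (rule lipschitz_on_extend_zero)
  have H0: "H x = 0" if "x \<notin> cball p r" for x using that by (simp add: H_def)
  have contH: "continuous_on UNIV H" using H by (rule lipschitz_on_continuous_on)
  have [measurable]: "H \<in> borel_measurable borel" using contH by (rule borel_measurable_continuous_onI)
  have intH: "integrable lborel H"
  proof -
    have "integrable lborel (\<lambda>x. indicator (cball p r) x *\<^sub>R H x)"
      using contH by (intro borel_integrable_compact) (auto intro: continuous_on_subset)
    also have "(\<lambda>x. indicator (cball p r) x *\<^sub>R H x) = H"
      by (rule ext) (use H0 in \<open>auto simp: indicator_def\<close>)
    finally show ?thesis .
  qed
  define q where "q n x = (H (x + (1 / real (Suc n)) *\<^sub>R e) - H x) / (1 / real (Suc n))" for n x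
  have intq: "integral\<^sup>L lborel (q n) = 0" for n
  proof -
    define v where "v = (1 / real (Suc n)) *\<^sub>R e"
    have "integrable (distr lborel borel ((+) v)) H" using intH by (simp add: lborel_distr_plus)
    then have "integrable lborel (\<lambda>x. H (v + x))" by (rule integrable_distr[rotated]) simp
    moreover have "integral\<^sup>L lborel H = integral\<^sup>L lborel (\<lambda>x. H (v + x))"
      using integral_distr[of "(+) v" lborel borel H] by (simp add: lborel_distr_plus)
    ultimately have "integral\<^sup>L lborel (\<lambda>x. H (x + v) - H x) = 0"
      using intH by (subst Bochner_Integration.integral_diff) (simp_all add: add.commute)
    then show ?thesis unfolding q_def v_def by (subst integral_divide_zero) simp
  qed
  \<comment> \<open>The shifts have length at most |e|, so outside this larger ball both values of
    \<open>H\<close> in the quotient are 0.\<close>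
  let ?B = "cball p (r + norm e)"
  have bound: "norm (q n x) \<le> indicator ?B x *\<^sub>R (L * norm e)" for n x
  proof (cases "x \<in> ?B")
    case True
    have "dist (H (x + (1 / real (Suc n)) *\<^sub>R e)) (H x) \<le> L * dist (x + (1 / real (Suc n)) *\<^sub>R e) x"
      by (rule lipschitz_onD[OF H]) auto
    then have "\<bar>H (x + (1 / real (Suc n)) *\<^sub>R e) - H x\<bar> \<le> L * norm e * (1 / real (Suc n))"
      by (simp add: dist_norm)
    then have "\<bar>q n x\<bar> \<le> L * norm e"
      unfolding q_def abs_divide by (subst divide_le_eq) auto
    then show ?thesis using True by simp
  next
    case False
    have "norm ((1 / real (Suc n)) *\<^sub>R e) \<le> norm e"
      by (simp add: divide_le_eq mult_le_cancel_left1)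
    then have "dist x (x + (1 / real (Suc n)) *\<^sub>R e) \<le> norm e" by (simp add: dist_norm)
    then have "x + (1 / real (Suc n)) *\<^sub>R e \<notin> cball p r" "x \<notin> cball p r"
      using False dist_triangle[of p x "x + (1 / real (Suc n)) *\<^sub>R e"] norm_ge_zero[of e]
      by (auto simp: dist_commute simp del: norm_ge_zero)
    then show ?thesis using False by (simp add: q_def H0)
  qed
  have lim_arg: "filterlim (\<lambda>n. 1 / real (Suc n)) (at 0) sequentially"
    unfolding filterlim_at using LIMSEQ_inverse_real_of_nat by (auto simp: inverse_eq_divide)
  have lim: "(\<lambda>n. q n x) \<longlonglongrightarrow> indicator (ball p r) x *\<^sub>R D x"
    if "x \<in> ball p r \<Longrightarrow> ((\<lambda>t. F (x + t *\<^sub>R e)) has_real_derivative D x) (at 0)" "x \<notin> sphere p r" for x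
  proof -
    have "((\<lambda>t. H (x + t *\<^sub>R e)) has_real_derivative indicator (ball p r) x *\<^sub>R D x) (at 0)"
    proof (cases "x \<in> ball p r")
      case True
      have "open ((\<lambda>t. x + t *\<^sub>R e) -` ball p r)" by (intro open_vimage continuous_intros) auto
      then have "((\<lambda>t. H (x + t *\<^sub>R e)) has_real_derivative D x) (at 0)"
        using that(1)[OF True] True unfolding has_field_derivative_def
        by (elim has_derivative_transform_within_open) (auto simp: H_def)
      then show ?thesis using True by simp
    next
      case False
      have "open ((\<lambda>t. x + t *\<^sub>R e) -` (- cball p r))" by (intro open_vimage continuous_intros) auto
      moreover have "((\<lambda>t. 0) has_real_derivative 0) (at 0)" by simp
      ultimately have "((\<lambda>t. H (x + t *\<^sub>R e)) has_real_derivative 0) (at 0)"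
        using False that(2) unfolding has_field_derivative_def
        by (elim has_derivative_transform_within_open) (auto simp: H0)
      then show ?thesis using False by simp
    qed
    then have "((\<lambda>t. (H (x + t *\<^sub>R e) - H x) / t) \<longlongrightarrow> indicator (ball p r) x *\<^sub>R D x) (at 0)"
      by (simp add: has_field_derivative_iff)
    from filterlim_compose[OF this lim_arg] show ?thesis by (simp add: q_def)
  qed
  \<comment> \<open>The extension \<open>H\<close> may have a kink across the sphere, so points
    there are discarded as a null set.\<close>
  have "sphere p r \<in> null_sets lborel"
    using negligible_sphere[of p r] by (simp add: negligible_iff_null_sets null_sets_completion_iff)
  then have "AE x in lborel. x \<notin> sphere p r" by (rule AE_not_in)
  then have AElim: "AE x in lborel. (\<lambda>n. q n x) \<longlonglongrightarrow> indicator (ball p r) x *\<^sub>R D x"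
    using der by eventually_elim (use lim in blast)
  have "(\<lambda>n. integral\<^sup>L lborel (q n)) \<longlonglongrightarrow> integral\<^sup>L lborel (\<lambda>x. indicator (ball p r) x *\<^sub>R D x)"
  proof (rule integral_dominated_convergence[where w = "\<lambda>x. indicator ?B x *\<^sub>R (L * norm e)"])
    show "integrable lborel (\<lambda>x. indicator ?B x *\<^sub>R (L * norm e))"
      by (intro borel_integrable_compact) auto
    show "q n \<in> borel_measurable lborel" for n unfolding q_def by measurable
    show "(\<lambda>x. indicator (ball p r) x *\<^sub>R D x) \<in> borel_measurable lborel"
      using D by (intro borel_measurable_scaleR borel_measurable_indicator) auto
  qed (use AElim bound in auto)
  then have "integral\<^sup>L lborel (\<lambda>x. indicator (ball p r) x *\<^sub>R D x) = 0"
    using LIMSEQ_unique[OF _ tendsto_const] by (simp add: intq)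
  then show ?thesis
    unfolding set_lebesgue_integral_def
    using D by (subst integral_completion)
      (auto intro!: borel_measurable_times borel_measurable_indicator)
qed

lemma
  shows C1_function_const: "C1_function (\<lambda>_::'a::euclidean_space. k)"
    and gradient_const: "gradient (\<lambda>_::'a. k) = (\<lambda>_. 0)"
proof -
  have "GDERIV (\<lambda>_. k) x :> 0" for x :: 'a by (rule GDERIV_const)
  moreover have "continuous_on UNIV (\<lambda>_::'a. 0 :: 'a)" by (rule continuous_on_const)
  ultimately show "C1_function (\<lambda>_::'a. k)" "gradient (\<lambda>_::'a. k) = (\<lambda>_. 0)"
    by (rule C1_functionI gradient_eq_fun)+
qed

lemma lipschitz_on_mult_bounded:
  fixes f g :: "'a::metric_space \<Rightarrow> real"
  assumes f: "L-lipschitz_on S f" and g: "K-lipschitz_on S g" and "0 \<le> A" "0 \<le> B"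
    and A: "\<And>x. x \<in> S \<Longrightarrow> \<bar>f x\<bar> \<le> A" and B: "\<And>x. x \<in> S \<Longrightarrow> \<bar>g x\<bar> \<le> B"
  shows "(A * K + B * L)-lipschitz_on S (\<lambda>x. f x * g x)"
proof (rule lipschitz_onI)
  fix x y assume xy: "x \<in> S" "y \<in> S"
  have "f x * g x - f y * g y = f x * (g x - g y) + g y * (f x - f y)" by (simp add: algebra_simps)
  then have "dist (f x * g x) (f y * g y) \<le> \<bar>f x\<bar> * dist (g x) (g y) + \<bar>g y\<bar> * dist (f x) (f y)"
    unfolding dist_real_def using abs_triangle_ineq[of "f x * (g x - g y)" "g y * (f x - f y)"]
    by (simp add: abs_mult)
  also have "\<dots> \<le> A * (K * dist x y) + B * (L * dist x y)"
    using xy assms by (intro add_mono mult_mono lipschitz_onD[OF f] lipschitz_onD[OF g]) auto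
  finally show "dist (f x * g x) (f y * g y) \<le> (A * K + B * L) * dist x y"
    by (simp add: algebra_simps)
qed (use assms lipschitz_on_nonneg[OF f] lipschitz_on_nonneg[OF g] in simp)

text \<open>The product of q and the positive part of h is Lipschitz and vanishes on the sphere, and
  almost everywhere its derivative along e is the integrand where h > 0 and 0 elsewhere. Working
  with the positive part on the whole ball avoids any boundary regularity of the set h > 0.\<close>

lemma integration_by_parts_positive_part:
  fixes h q :: "'a::euclidean_space \<Rightarrow> real"
  assumes h: "C1_function h" and q: "C1_function q" and r: "0 < r"
    and sphere: "\<And>x. x \<in> sphere p r \<Longrightarrow> h x \<le> 0"
  shows "(LINT x:{x \<in> ball p r. 0 < h x}|lebesgue.
      gradient h x \<bullet> e * q x + h x * (gradient q x \<bullet> e)) = 0"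
proof -
  \<comment> \<open>The negative of the positive part of \<open>h\<close>, written as a minimum so
    that \<open>GDERIV_min\<close> and \<open>lipschitz_on_min\<close> apply.\<close>
  define m where "m x = min 0 (- h x)" for x
  define D where "D x = (if 0 < h x then gradient h x \<bullet> e * q x + h x * (gradient q x \<bullet> e) else 0)" for x
  have [measurable]: "h \<in> borel_measurable borel" "q \<in> borel_measurable borel"
    "gradient h \<in> borel_measurable borel" "gradient q \<in> borel_measurable borel"
    using C1_function_continuous C1_function_continuous_gradient h q
    by (auto intro!: borel_measurable_continuous_onI)
  have mh: "C1_function (\<lambda>x. - h x)" "gradient (\<lambda>x. - h x) x = - gradient h x" for x
    using h by (auto intro!: C1_function_uminus gradient_eqI GDERIV_minus C1_function_GDERIV)
  have "\<exists>L. L-lipschitz_on (cball p r) (\<lambda>x. - m x * q x)"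
  proof -
    obtain L K where LK: "L-lipschitz_on (cball p r) (\<lambda>x. - h x)" "K-lipschitz_on (cball p r) q"
      using C1_function_lipschitz_on_cball[OF mh(1)] C1_function_lipschitz_on_cball[OF q] by blast
    have "(max 0 L)-lipschitz_on (cball p r) m"
      unfolding m_def by (intro lipschitz_on_min lipschitz_on_constant LK)
    then have lm: "(max 0 L)-lipschitz_on (cball p r) (\<lambda>x. - m x)" by (rule lipschitz_on_minus)
    have "\<exists>A\<ge>0. \<forall>x\<in>cball p r. \<bar>f x\<bar> \<le> A" if "N-lipschitz_on (cball p r) f" for N and f :: "'a \<Rightarrow> real"
    proof -
      have "compact (f ` cball p r)"
        using lipschitz_on_continuous_on[OF that] by (intro compact_continuous_image) auto
      then have "bounded (f ` cball p r)" by (rule compact_imp_bounded)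
      then obtain A where "A > 0" "\<forall>y\<in>f ` cball p r. norm y \<le> A"
        unfolding bounded_pos by blast
      then show ?thesis by (intro exI[of _ A]) auto
    qed
    then obtain A B where "0 \<le> A" "0 \<le> B" "\<forall>x\<in>cball p r. \<bar>- m x\<bar> \<le> A" "\<forall>x\<in>cball p r. \<bar>q x\<bar> \<le> B"
      using lm LK(2) by blast
    then have "(A * K + B * max 0 L)-lipschitz_on (cball p r) (\<lambda>x. - m x * q x)"
      by (intro lipschitz_on_mult_bounded lm LK(2)) auto
    then show ?thesis ..
  qed
  then obtain L where L: "L-lipschitz_on (cball p r) (\<lambda>x. - m x * q x)" ..
  have "(LINT x:ball p r|lebesgue. D x) = 0"
  proof (rule integral_directional_derivative_zero[OF L r])
    show "- m x * q x = 0" if "x \<in> sphere p r" for x using sphere[OF that] by (simp add: m_def)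
    show "D \<in> borel_measurable borel" unfolding D_def by measurable
    have "AE x in lborel. h x = 0 \<longrightarrow> gradient h x = 0" by (rule AE_gradient_zero_on_zero_set) fact
    then show "AE x in lborel. x \<in> ball p r \<longrightarrow>
        ((\<lambda>t. - m (x + t *\<^sub>R e) * q (x + t *\<^sub>R e)) has_real_derivative D x) (at 0)"
    proof eventually_elim
      case (elim x)
      have "GDERIV m x :> (if 0 < h x then - gradient h x else 0)"
        using GDERIV_min[OF C1_function_const[of 0] mh(1), of x] elim
        by (cases "0 < h x") (simp_all add: m_def[abs_def] gradient_const mh(2))
      then have "GDERIV (\<lambda>x. - m x * q x) x :> (- m x) *\<^sub>R gradient q x +
          q x *\<^sub>R - (if 0 < h x then - gradient h x else 0)"
        by (intro GDERIV_mult GDERIV_minus C1_function_GDERIV q)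
      then have "((\<lambda>t. - m (x + t *\<^sub>R e) * q (x + t *\<^sub>R e)) has_real_derivative
          ((- m x) *\<^sub>R gradient q x + q x *\<^sub>R - (if 0 < h x then - gradient h x else 0)) \<bullet> e) (at 0)"
        by (intro GDERIV_along_line) simp
      moreover have "((- m x) *\<^sub>R gradient q x + q x *\<^sub>R - (if 0 < h x then - gradient h x else 0)) \<bullet> e = D x"
        by (auto simp: D_def m_def inner_add_left algebra_simps)
      ultimately show ?case by simp
    qed
  qed
  also have "(LINT x:ball p r|lebesgue. D x) = (LINT x:{x \<in> ball p r. 0 < h x}|lebesgue.
      gradient h x \<bullet> e * q x + h x * (gradient q x \<bullet> e))"
    unfolding set_lebesgue_integral_def
    by (rule arg_cong[of _ _ "integral\<^sup>L lebesgue"]) (auto simp: D_def indicator_def)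
  finally show ?thesis .
qed

text \<open>The integrand vanishes almost everywhere on S, and the exceptional set is open by
  continuity; a nonempty open set is not negligible.\<close>

lemma set_integral_nonpos_imp_zero:
  fixes k :: "'a::euclidean_space \<Rightarrow> real"
  assumes k: "continuous_on UNIV k" and S: "open S" "bounded S"
    and nonneg: "\<And>x. x \<in> S \<Longrightarrow> 0 \<le> k x" and le: "(LINT x:S|lebesgue. k x) \<le> 0" and x: "x \<in> S"
  shows "k x = 0"
proof -
  have int: "integrable lebesgue (\<lambda>x. indicator S x *\<^sub>R k x)"
    using continuous_set_integrable_lebesgue[OF k] S unfolding set_integrable_def by auto
  have ae: "AE x in lebesgue. 0 \<le> indicator S x *\<^sub>R k x" using nonneg by (auto simp: indicator_def)
  have "integral\<^sup>L lebesgue (\<lambda>x. indicator S x *\<^sub>R k x) = 0"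
    using le integral_nonneg_AE[OF ae] unfolding set_lebesgue_integral_def by simp
  then have "AE x in lebesgue. indicator S x *\<^sub>R k x = 0"
    using integral_nonneg_eq_0_iff_AE[OF int ae] by simp
  then have "AE x in lborel. indicator S x *\<^sub>R k x = 0" by (simp add: AE_completion_iff)
  then have AE: "AE x in lborel. x \<notin> S \<inter> {x. k x \<noteq> 0}"
    by eventually_elim (auto simp: indicator_def)
  have "open {x. k x \<noteq> 0}" using k by (intro open_Collect_neq) auto
  with S have open_set: "open (S \<inter> {x. k x \<noteq> 0})" by auto
  then have "S \<inter> {x. k x \<noteq> 0} \<in> null_sets lborel"
    using AE by (subst AE_iff_null_sets) auto
  then have "negligible (S \<inter> {x. k x \<noteq> 0})"
    by (simp add: negligible_iff_null_sets null_sets_completionI)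
  then have "S \<inter> {x. k x \<noteq> 0} = {}" using open_set open_not_negligible by blast
  then show ?thesis using x by auto
qed

section \<open>The potential at the maximum\<close>

lemma maximum_above_limit:
  fixes u :: "'a::euclidean_space \<Rightarrow> real"
  assumes u: "continuous_on UNIV u" and lim: "(u \<longlongrightarrow> a) at_infinity" and x: "a < u x"
  obtains z where "a < u z" "\<And>y. u y \<le> u z"
proof -
  have "\<forall>\<^sub>F y in at_infinity. u y < u x" using lim x by (rule order_tendstoD)
  then obtain R where R: "\<And>y. R \<le> norm y \<Longrightarrow> u y < u x" by (auto simp: eventually_at_infinity)
  let ?K = "cball (0::'a) (max R (norm x))"
  have "\<exists>z\<in>?K. \<forall>y\<in>?K. u y \<le> u z"
    using continuous_on_subset[OF u] by (intro continuous_attains_sup) auto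
  then obtain z where z: "\<And>y. y \<in> ?K \<Longrightarrow> u y \<le> u z" by blast
  have "u x \<le> u z" by (rule z) simp
  have "u y \<le> u z" for y
  proof (cases "R \<le> norm y")
    case True
    then show ?thesis using R[of y] \<open>u x \<le> u z\<close> by simp
  qed (use z[of y] in simp)
  moreover have "a < u z" using x \<open>u x \<le> u z\<close> by simp
  ultimately show ?thesis by (rule that[rotated])
qed

lemma bounded_below_if_limit:
  fixes u :: "'a::euclidean_space \<Rightarrow> real"
  assumes u: "continuous_on UNIV u" and lim: "(u \<longlongrightarrow> a) at_infinity"
  obtains m where "\<And>y. m \<le> u y"
proof (cases "\<exists>x. u x < a")
  case True
  then obtain x where "- a < - u x" by auto
  moreover have "continuous_on UNIV (\<lambda>x. - u x)" using u by (rule continuous_on_minus)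
  moreover have "((\<lambda>x. - u x) \<longlongrightarrow> - a) at_infinity" using lim by (rule tendsto_minus)
  ultimately obtain z where "\<And>y. - u y \<le> - u z" using maximum_above_limit by metis
  then have "u z \<le> u y" for y by simp
  then show ?thesis by (rule that)
next
  case False
  then have "a \<le> u y" for y by (auto simp: not_less)
  then show ?thesis by (rule that)
qed

text \<open>The level set M is closed by continuity and open because u is constant on small balls
  inside V, so it is everything by connectedness of the space. V itself need not be
  connected.\<close>

lemma locally_constant_maximum_imp_constant:
  fixes u :: "'a::euclidean_space \<Rightarrow> real"
  assumes u: "C1_function u" and V: "open V" and x0: "u x0 = M"
    and sub: "\<And>x. u x = M \<Longrightarrow> x \<in> V" and grad: "\<And>x. x \<in> V \<Longrightarrow> gradient u x = 0"
  shows "u x = M"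
proof -
  let ?Z = "{x. u x = M}"
  have "closed ?Z"
    using C1_function_continuous[OF u, of UNIV] by (intro closed_Collect_eq) auto
  moreover have "open ?Z"
  proof (rule openI)
    fix x assume "x \<in> ?Z"
    then have x: "u x = M" by simp
    then obtain e where e: "e > 0" "ball x e \<subseteq> V" using V sub openE by blast
    have "\<exists>c. \<forall>y\<in>ball x e. u y = c"
    proof (rule has_derivative_zero_constant)
      fix y assume "y \<in> ball x e"
      then have "gradient u y = 0" using e grad by blast
      then have "(u has_derivative (\<lambda>h. 0)) (at y)"
        using C1_function_GDERIV[OF u, of y] by (simp add: gderiv_def)
      then show "(u has_derivative (\<lambda>h. 0)) (at y within ball x e)"
        by (rule has_derivative_at_withinI)
    qed simp
    then obtain c where c: "\<forall>y\<in>ball x e. u y = c" ..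
    moreover have "c = M" using c x e(1) by auto
    ultimately show "\<exists>e>0. ball x e \<subseteq> ?Z" using e(1) by (intro exI[of _ e]) auto
  qed
  ultimately have "?Z = UNIV" using x0 clopen[of ?Z] by auto
  then show ?thesis by auto
qed

text \<open>Otherwise cutting u off at s lowers neither energy term strictly only if grad u = 0
  wherever u > s. The maximum then spreads to the whole space, although u < s far out.\<close>

lemma minimizer_level_below_max:
  fixes u :: "'a::euclidean_space \<Rightarrow> real"
  assumes min: "energy_minimizer G u" and G: "continuous_on UNIV G" and lim: "(u \<longlongrightarrow> a) at_infinity"
    and max: "\<And>x. u x \<le> M" and x0: "u x0 = M" and s: "a < s" "s < M"
  shows "\<exists>t\<in>{s..M}. G t < G s"
proof (rule ccontr)
  assume "\<not> (\<exists>t\<in>{s..M}. G t < G s)"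
  then have Gs: "G s \<le> G t" if "s \<le> t" "t \<le> M" for t using that by force
  have u: "C1_function u" using min by (simp add: energy_minimizer_def)
  have "\<forall>\<^sub>F y in at_infinity. u y < s" using lim s(1) by (rule order_tendstoD)
  then obtain R' where R': "\<And>y. R' \<le> norm y \<Longrightarrow> u y < s" by (auto simp: eventually_at_infinity)
  define R where "R = max R' 1"
  have R: "0 < R" "\<And>y. R \<le> norm y \<Longrightarrow> u y < s" using R' by (auto simp: R_def)
  let ?S = "{x \<in> ball 0 R. s < u x}"
  have S: "open ?S"
  proof -
    have "open {x. s < u x}"
      using C1_function_continuous[OF u, of UNIV] by (intro open_Collect_less) auto
    then have "open (ball 0 R \<inter> {x. s < u x})" by (intro open_Int open_ball)
    also have "ball 0 R \<inter> {x. s < u x} = ?S" by auto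
    finally show ?thesis .
  qed
  have "(LINT x:?S|lebesgue. energy_density G u x - energy_density G (\<lambda>_. s) x) \<le> 0"
    using R(2) by (intro min_comparison[OF min G C1_function_const R(1)]) force
  then have le: "(LINT x:?S|lebesgue. energy_density G u x - G s) \<le> 0"
    by (simp add: gradient_const)
  have grad: "gradient u x = 0" if x: "x \<in> ?S" for x
  proof -
    have ge: "G s \<le> G (u y)" if "y \<in> ?S" for y using that max by (intro Gs) auto
    have "energy_density G u x - G s = 0"
    proof (rule set_integral_nonpos_imp_zero[OF _ S _ _ le x])
      show "continuous_on UNIV (\<lambda>x. energy_density G u x - G s)"
        by (intro continuous_on_diff continuous_energy_density G u continuous_on_const)
      show "bounded ?S" by (rule bounded_subset[OF bounded_ball[of 0 R]]) auto
      show "0 \<le> energy_density G u y - G s" if "y \<in> ?S" for y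
        using ge[OF that] zero_le_power2[of "norm (gradient u y)"] by linarith
    qed
    then have "(norm (gradient u x))\<^sup>2 \<le> 0" using ge[OF x] by linarith
    then show ?thesis by simp
  qed
  have "u x = M" for x
  proof (rule locally_constant_maximum_imp_constant[OF u S x0 _ grad])
    show "x \<in> ?S" if "u x = M" for x using that s R(2)[of x] by force
  qed
  moreover obtain x :: 'a where "norm x = R" using vector_choose_size[OF less_imp_le[OF R(1)]] by blast
  ultimately show False using R(2)[of x] s by simp
qed

text \<open>A minimum point t of G on [s, M] must be M: for t < M the preceding lemma finds a
  smaller value on [t, M].\<close>

lemma minimizer_potential_le_below_max:
  fixes u :: "'a::euclidean_space \<Rightarrow> real"
  assumes min: "energy_minimizer G u" and G: "continuous_on UNIV G" and lim: "(u \<longlongrightarrow> a) at_infinity"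
    and max: "\<And>x. u x \<le> M" and x0: "u x0 = M" and s: "a < s" "s \<le> M"
  shows "G M \<le> G s"
proof -
  have "\<exists>t\<in>{s..M}. \<forall>y\<in>{s..M}. G t \<le> G y"
    using s continuous_on_subset[OF G] by (intro continuous_attains_inf) auto
  then obtain t where t: "t \<in> {s..M}" "\<And>y. y \<in> {s..M} \<Longrightarrow> G t \<le> G y" by blast
  have "t = M"
  proof (rule ccontr)
    assume "t \<noteq> M"
    then obtain y where "y \<in> {t..M}" "G y < G t"
      using minimizer_level_below_max[OF min G lim max x0, of t] t(1) s(1) by force
    then show False using t(1) t(2)[of y] by simp
  qed
  then show ?thesis using t s by auto
qed

text \<open>Squaring removes the kink of the positive part, so the transition profile built from it
  below is C^1 across the inner sphere.\<close>

lemma DERIV_positive_part_square: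
  "((\<lambda>t::real. (max 0 t)\<^sup>2) has_real_derivative 2 * max 0 t) (at t)"
proof -
  consider "t < 0" | "0 < t" | "t = 0" by linarith
  then show ?thesis
  proof cases
    case 1
    have "((\<lambda>t::real. 0) has_real_derivative 0) (at t)" by simp
    then have "((\<lambda>t::real. (max 0 t)\<^sup>2) has_real_derivative 0) (at t)"
      by (rule has_field_derivative_transform_within_open[of _ _ _ "{..<0}"]) (use 1 in auto)
    then show ?thesis using 1 by simp
  next
    case 2
    have "((\<lambda>t::real. t\<^sup>2) has_real_derivative 2 * t) (at t)" by (auto intro!: derivative_eq_intros)
    then have "((\<lambda>t::real. (max 0 t)\<^sup>2) has_real_derivative 2 * t) (at t)"
      by (rule has_field_derivative_transform_within_open[of _ _ _ "{0<..}"]) (use 2 in auto)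
    then show ?thesis using 2 by simp
  next
    case 3
    have "((\<lambda>h::real. (max 0 h)\<^sup>2 / h) \<longlongrightarrow> 0) (at 0)"
    proof (rule Lim_null_comparison)
      show "\<forall>\<^sub>F h::real in at 0. norm ((max 0 h)\<^sup>2 / h) \<le> \<bar>h\<bar>"
        by (rule always_eventually) (auto simp: max_def power2_eq_square)
      show "((\<lambda>h::real. \<bar>h\<bar>) \<longlongrightarrow> 0) (at 0)" by (rule tendsto_rabs_zero) (rule tendsto_ident_at)
    qed
    then show ?thesis using 3 by (simp add: has_field_derivative_iff)
  qed
qed

text \<open>If G c < G a, then on a large ball it pays to lift u to the constant c: the gain is
  proportional to the volume, and the transition happens in a thin shell with small gradient.\<close>

lemma minimizer_potential_ge_above_max:
  fixes u :: "'a::euclidean_space \<Rightarrow> real"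
  assumes min: "energy_minimizer G u" and G: "continuous_on UNIV G" and lim: "(u \<longlongrightarrow> a) at_infinity"
    and c: "\<And>x. u x < c"
  shows "G a \<le> G c"
proof (rule ccontr)
  assume "\<not> G a \<le> G c"
  define \<eta> where "\<eta> = G a - G c"
  have \<eta>: "0 < \<eta>" using \<open>\<not> G a \<le> G c\<close> by (simp add: \<eta>_def)
  define n where "n = DIM('a)"
  have n: "0 < n" by (simp add: n_def)
  have u: "C1_function u" using min by (simp add: energy_minimizer_def)
  obtain m where m: "\<And>x. m \<le> u x"
    using bounded_below_if_limit[OF C1_function_continuous[OF u] lim] by blast
  have mc: "m < c" using m[of 0] c[of 0] by simp
  have "compact (G ` {m..c})" using G by (intro compact_continuous_image) (auto intro: continuous_on_subset)
  then have "bounded (G ` {m..c})" by (rule compact_imp_bounded)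
  then obtain B where B: "0 < B" "\<forall>y\<in>G ` {m..c}. norm y \<le> B" unfolding bounded_pos by blast
  have GB: "- B \<le> G t" "G t \<le> B" if "m \<le> t" "t \<le> c" for t
  proof -
    have "norm (G t) \<le> B" using B(2) that by auto
    then show "- B \<le> G t" "G t \<le> B" by auto
  qed
  have "isCont G a" using G by (simp add: continuous_on_eq_continuous_at)
  then have "((\<lambda>x. G (u x)) \<longlongrightarrow> G a) at_infinity" using lim by (rule isCont_tendsto_compose)
  then have "\<forall>\<^sub>F x in at_infinity. G a - \<eta>/2 < G (u x)"
    using \<eta> by (intro order_tendstoD) auto
  then obtain R0' where R0': "\<And>x. R0' \<le> norm x \<Longrightarrow> G a - \<eta>/2 < G (u x)"
    by (auto simp: eventually_at_infinity)
  define R0 where "R0 = max R0' 1"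
  have R0: "0 < R0" "\<And>x. R0 \<le> norm x \<Longrightarrow> G a - \<eta>/2 < G (u x)" using R0' by (auto simp: R0_def)
  have "\<forall>\<^sub>F l in at_left (1::real). (\<eta>/2 + 2*B) * (1 - l^n) < \<eta>/2"
  proof (rule order_tendstoD)
    show "((\<lambda>l. (\<eta>/2 + 2*B) * (1 - l^n)) \<longlongrightarrow> (\<eta>/2 + 2*B) * (1 - 1^n)) (at_left 1)"
      by (intro tendsto_intros)
  qed (use \<eta> in simp)
  moreover have "\<forall>\<^sub>F l in at_left (1::real). l \<in> {0<..<1}" by (rule eventually_at_left_real) simp
  ultimately have "\<forall>\<^sub>F l in at_left (1::real). (\<eta>/2 + 2*B) * (1 - l^n) < \<eta>/2 \<and> l \<in> {0<..<1}"
    by (rule eventually_conj)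
  \<comment> \<open>The shell between radii l R and R takes up the fraction 1 - l^n of the volume,
    so for l near 1 its cost 2B per unit volume is outweighed by the gain \<eta>/2 in the inner
    ball. The choice precedes that of R, so that \<open>Q\<close> does not depend on R.\<close>
  from eventually_happens'[OF trivial_limit_at_left_real this]
  obtain l where l: "(\<eta>/2 + 2*B) * (1 - l^n) < \<eta>/2" "0 < l" "l < 1" by auto
  have l2: "l\<^sup>2 < 1" using l(2,3) by (simp add: power_less_one_iff)
  define Q where "Q = 4 * (c - m) / (1 - l\<^sup>2)"
  \<comment> \<open>The balance of gain and loss, divided by the volume of the unit ball. Inside
    radius R0 the gain may fail and the loss reach 2B, hence the correction \<eta>/2 + 2B there; the
    shell costs 2B for the potential and (Q/R)^2/2 for the gradient.\<close>
  have key: "\<eta>/2 * (l*R)^n - (\<eta>/2 + 2*B) * R0^n - (2*B + (Q/R)\<^sup>2/2) * (R^n - (l*R)^n) \<le> 0"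
    if R: "0 < R" for R
  proof -
    define h where "h = R\<^sup>2 * (1 - l\<^sup>2)"
    have h: "0 < h" using R l2 by (simp add: h_def)
    define K where "K = (c - m) / h\<^sup>2"
    have K: "0 < K" "K * h\<^sup>2 = c - m" using mc h by (auto simp: K_def)
    \<comment> \<open>The profile equals c in the ball of radius l R. On the outer sphere
      \<open>P\<close> equals \<open>h\<close>, and \<open>K\<close> is chosen so that \<rho> has
      come down there exactly to the lower bound m of u.\<close>
    define P where "P x = max 0 (x \<bullet> x - (l*R)\<^sup>2)" for x :: 'a
    define \<rho> where "\<rho> x = c - K * (P x)\<^sup>2" for x
    have P: "0 \<le> P x" "P x \<le> h" if "norm x \<le> R" for x
    proof -
      have "x \<bullet> x \<le> R\<^sup>2" using that by (simp add: dot_square_norm power_mono)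
      then show "0 \<le> P x" "P x \<le> h" using h by (auto simp: P_def h_def algebra_simps power_mult_distrib)
    qed
    have D\<rho>: "GDERIV \<rho> x :> (- (K * (2 * P x))) *\<^sub>R (2 *\<^sub>R x)" for x
    proof -
      have "GDERIV (\<lambda>x. x \<bullet> x - (l*R)\<^sup>2) x :> 2 *\<^sub>R x"
        unfolding gderiv_def by (auto intro!: derivative_eq_intros simp: inner_commute)
      moreover have "((\<lambda>t. c - K * (max 0 t)\<^sup>2) has_real_derivative - (K * (2 * max 0 t))) (at t)" for t
        using DERIV_diff[OF DERIV_const[of c] DERIV_cmult[OF DERIV_positive_part_square, of K]] by simp
      ultimately have "GDERIV (\<lambda>x. c - K * (max 0 (x \<bullet> x - (l*R)\<^sup>2))\<^sup>2) x :>
          (- (K * (2 * max 0 (x \<bullet> x - (l*R)\<^sup>2)))) *\<^sub>R (2 *\<^sub>R x)"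
        by (rule GDERIV_DERIV_compose)
      then show ?thesis by (simp add: \<rho>_def[abs_def] P_def)
    qed
    have contD: "continuous_on UNIV (\<lambda>x::'a. (- (K * (2 * P x))) *\<^sub>R (2 *\<^sub>R x))"
      unfolding P_def by (intro continuous_intros)
    note \<rho> = C1_functionI[OF D\<rho> contD]
    have grad\<rho>: "gradient \<rho> x = (- (K * (2 * P x))) *\<^sub>R (2 *\<^sub>R x)" for x
      using gradient_eq_fun[OF D\<rho> contD] by simp
    have KP: "0 \<le> K * (P x)\<^sup>2" "K * (P x)\<^sup>2 \<le> c - m" if "norm x \<le> R" for x
    proof -
      show "0 \<le> K * (P x)\<^sup>2" using K by simp
      have "K * (P x)\<^sup>2 \<le> K * h\<^sup>2" using P[OF that] K by (intro mult_left_mono power_mono) auto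
      then show "K * (P x)\<^sup>2 \<le> c - m" using K by simp
    qed
    have norm_grad: "norm (gradient \<rho> x) \<le> Q / R" if "norm x \<le> R" for x
    proof -
      have "norm (gradient \<rho> x) = 4 * K * P x * norm x"
        using K P[OF that] by (simp add: grad\<rho> abs_mult)
      also have "\<dots> \<le> 4 * K * h * R" using K P[OF that] that by (intro mult_mono mult_left_mono) auto
      also have "4 * K * h * R = 4 * (c - m) * (R / h)" using h by (simp add: K_def power2_eq_square)
      also have "R / h = 1 / ((1 - l\<^sup>2) * R)" using R by (simp add: h_def power2_eq_square)
      also have "4 * (c - m) * (1 / ((1 - l\<^sup>2) * R)) = Q / R" by (simp add: Q_def)
      finally show ?thesis .
    qed
    let ?S = "{x \<in> ball 0 R. u x < \<rho> x}"
    let ?d = "\<lambda>x. energy_density G u x - energy_density G \<rho> x"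
    have le: "(LINT x:?S|lebesgue. ?d x) \<le> 0"
    proof (rule max_comparison[OF min G \<rho> R])
      fix x :: 'a assume "x \<in> sphere 0 R"
      then have "x \<bullet> x = R\<^sup>2" by (simp add: dot_square_norm)
      then have "P x = h" using h by (simp add: P_def h_def algebra_simps power_mult_distrib)
      then show "\<rho> x \<le> u x" using K m[of x] by (simp add: \<rho>_def)
    qed
    \<comment> \<open>A lower bound built from indicators of balls, whose integral is explicit
      whatever the shape of \<open>?S\<close>.\<close>
    define b where "b x = \<eta>/2 * indicator (ball 0 (l*R)) x - (\<eta>/2 + 2*B) * indicator (ball 0 R0) x
        - (2*B + (Q/R)\<^sup>2/2) * (indicator (ball 0 R) x - indicator (ball 0 (l*R)) x)" for x :: 'a
    have lR: "l * R < R" using l R by simp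
    have bound: "b x \<le> indicator ?S x *\<^sub>R ?d x" for x
    proof (cases "x \<in> ball 0 R")
      case False
      then have "b x = - ((\<eta>/2 + 2*B) * indicator (ball 0 R0) x)" using lR by (simp add: b_def)
      also have "\<dots> \<le> 0" using \<eta> B by (simp add: indicator_def)
      finally show ?thesis using False by simp
    next
      case True
      then have x: "norm x \<le> R" by simp
      have Gu: "- B \<le> G (u x)" using GB m[of x] c[of x] by simp
      have G\<rho>: "G (\<rho> x) \<le> B" using KP[OF x] by (intro GB) (simp_all add: \<rho>_def)
      have d: "?d x \<ge> G (u x) - G (\<rho> x) - (norm (gradient \<rho> x))\<^sup>2 / 2"
        using zero_le_power2[of "norm (gradient u x)"] by linarith
      show ?thesis
      proof (cases "norm x < l * R")
        case in_lR: True
        have "x \<bullet> x \<le> (l*R)\<^sup>2" using in_lR by (simp add: dot_square_norm power_mono)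
        then have "P x = 0" by (simp add: P_def)
        then have "\<rho> x = c" "gradient \<rho> x = 0" by (simp_all add: \<rho>_def grad\<rho>)
        \<comment> \<open>The strict bound u < c puts the whole inner ball into \<open>?S\<close>,
          so the gain is collected on all of it.\<close>
        moreover from this have "x \<in> ?S" using True c by simp
        ultimately have ge: "G (u x) - G c \<le> indicator ?S x *\<^sub>R ?d x" using d by simp
        have b: "b x = \<eta>/2 - (\<eta>/2 + 2*B) * indicator (ball 0 R0) x"
          using True in_lR by (simp add: b_def)
        show ?thesis
        proof (cases "norm x < R0")
          case True
          have "G c \<le> B" using GB(2)[of c] mc by simp
          then show ?thesis using ge Gu b True by simp
        next
          case False
          then show ?thesis using ge R0(2)[of x] b by (simp add: \<eta>_def field_simps)
        qed
      next
        case False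
        have "b x = - ((\<eta>/2 + 2*B) * indicator (ball 0 R0) x) - (2*B + (Q/R)\<^sup>2/2)"
          using True False by (simp add: b_def)
        moreover have "0 \<le> (\<eta>/2 + 2*B) * indicator (ball 0 R0) x" using \<eta> B by simp
        ultimately have b: "b x \<le> - (2*B + (Q/R)\<^sup>2/2)" by linarith
        have sq: "(norm (gradient \<rho> x))\<^sup>2 \<le> (Q/R)\<^sup>2" using norm_grad[OF x] by (intro power_mono) auto
        show ?thesis
        proof (cases "x \<in> ?S")
          case True
          have "- (2*B + (Q/R)\<^sup>2/2) \<le> ?d x" using Gu G\<rho> d sq by linarith
          then show ?thesis using True b by simp
        next
          case False
          have "0 \<le> 2*B + (Q/R)\<^sup>2/2" using B by simp
          then show ?thesis using False b by simp
        qed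
      qed
    qed
    have ind: "integrable lebesgue (indicator (ball (0::'a) t) :: 'a \<Rightarrow> real)" for t
      by (simp add: lmeasurable_iff_integrable[symmetric])
    have vol: "measure lebesgue (ball (0::'a) t) = unit_ball_vol (real n) * t^n" if "0 \<le> t" for t
      using content_ball[OF that, of "0::'a"] by (simp add: n_def)
    have intb: "integrable lebesgue b"
      unfolding b_def by (intro Bochner_Integration.integrable_diff integrable_mult_right ind)
    have "integral\<^sup>L lebesgue b = \<eta>/2 * measure lebesgue (ball (0::'a) (l*R))
        - (\<eta>/2 + 2*B) * measure lebesgue (ball (0::'a) R0)
        - (2*B + (Q/R)\<^sup>2/2) * (measure lebesgue (ball (0::'a) R) - measure lebesgue (ball (0::'a) (l*R)))"
      unfolding b_def using ind
      by (simp only: Bochner_Integration.integral_diff integrable_mult_right integral_mult_right_zero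
          Bochner_Integration.integrable_diff) simp
    also have "\<dots> = unit_ball_vol (real n) * (\<eta>/2 * (l*R)^n - (\<eta>/2 + 2*B) * R0^n
        - (2*B + (Q/R)\<^sup>2/2) * (R^n - (l*R)^n))"
      unfolding vol[OF less_imp_le[OF R]] vol[OF less_imp_le[OF R0(1)]]
        vol[OF mult_nonneg_nonneg[OF less_imp_le[OF l(2)] less_imp_le[OF R]]]
      by (simp only: right_diff_distrib mult.left_commute[of _ "unit_ball_vol (real n)"])
    finally have intb_eq: "integral\<^sup>L lebesgue b = \<dots>" .
    have S: "open ?S"
    proof -
      have "open {x. u x < \<rho> x}"
        using C1_function_continuous[OF u, of UNIV] C1_function_continuous[OF \<rho>, of UNIV]
        by (intro open_Collect_less)
      then have "open (ball 0 R \<inter> {x. u x < \<rho> x})" by (intro open_Int open_ball)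
      also have "ball 0 R \<inter> {x. u x < \<rho> x} = ?S" by auto
      finally show ?thesis .
    qed
    have "set_integrable lebesgue ?S ?d"
      using S by (intro continuous_set_integrable_lebesgue continuous_on_diff continuous_energy_density G u \<rho>)
        (auto intro: bounded_subset[OF bounded_ball[of 0 R]])
    then have "integral\<^sup>L lebesgue b \<le> integral\<^sup>L lebesgue (\<lambda>x. indicator ?S x *\<^sub>R ?d x)"
      unfolding set_integrable_def using intb bound by (intro integral_mono)
    also have "\<dots> \<le> 0" using le by (simp add: set_lebesgue_integral_def)
    finally show ?thesis
      unfolding intb_eq using unit_ball_vol_pos[OF of_nat_0_le_iff, of n] by (simp add: mult_le_0_iff)
  qed
  \<comment> \<open>Dividing by R^n and letting R tend to infinity removes the core of radius R0 and
    the gradient cost, leaving a comparison that contradicts the choice of l.\<close>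
  have "\<eta>/2 * l^n - (\<eta>/2 + 2*B) * 0^n - (2*B + 0\<^sup>2/2) * (1 - l^n) \<le> 0"
  proof (rule tendsto_upperbound)
    show "((\<lambda>R. \<eta>/2 * l^n - (\<eta>/2 + 2*B) * (R0/R)^n - (2*B + (Q/R)\<^sup>2/2) * (1 - l^n)) \<longlongrightarrow>
        \<eta>/2 * l^n - (\<eta>/2 + 2*B) * 0^n - (2*B + 0\<^sup>2/2) * (1 - l^n)) at_top"
      by (intro tendsto_intros tendsto_divide_0[OF tendsto_const] filterlim_at_top_imp_at_infinity filterlim_ident) simp_all
    show "\<forall>\<^sub>F R in at_top. \<eta>/2 * l^n - (\<eta>/2 + 2*B) * (R0/R)^n - (2*B + (Q/R)\<^sup>2/2) * (1 - l^n) \<le> 0"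
      using eventually_gt_at_top[of 0]
    proof eventually_elim
      case (elim R)
      have "(\<eta>/2 * l^n - (\<eta>/2 + 2*B) * (R0/R)^n - (2*B + (Q/R)\<^sup>2/2) * (1 - l^n)) * R^n =
          \<eta>/2 * (l*R)^n - (\<eta>/2 + 2*B) * R0^n - (2*B + (Q/R)\<^sup>2/2) * (R^n - (l*R)^n)"
        using elim by (simp add: algebra_simps power_divide power_mult_distrib)
      then show ?case using key[OF elim] elim by (metis mult_le_0_iff not_less zero_less_power)
    qed
  qed simp
  then have "\<eta>/2 * l^n \<le> 2*B * (1 - l^n)" using n by (simp add: zero_power)
  moreover have "(\<eta>/2 + 2*B) * (1 - l^n) = \<eta>/2 - \<eta>/2 * l^n + 2*B * (1 - l^n)"
    by (simp only: distrib_right right_diff_distrib mult_1_right)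
  ultimately show False using l(1) by linarith
qed

section \<open>The strong maximum principle\<close>

text \<open>Let z be a point of Z nearest to x0. The ball around x0 through z may touch Z elsewhere
  too; the ball with diameter from x0 to z lies inside it and meets its sphere only at z.\<close>

lemma interior_touching_ball:
  fixes Z :: "'a::euclidean_space set"
  assumes Z: "closed Z" "Z \<noteq> {}" and x0: "x0 \<notin> Z"
  obtains c r z where "0 < r" "z \<in> Z" "dist c z = r" "\<And>y. y \<in> Z \<Longrightarrow> dist c y \<le> r \<Longrightarrow> y = z"
proof -
  obtain z where z: "z \<in> Z" "\<And>y. y \<in> Z \<Longrightarrow> dist x0 z \<le> dist x0 y"
    using distance_attains_inf[OF Z, of x0] by blast
  define v where "v = (1/2) *\<^sub>R (z - x0)"
  define c where "c = x0 + v"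
  have zc: "z - c = v" by (simp add: c_def v_def algebra_simps flip: scaleR_add_left)
  have v: "v \<noteq> 0" using z(1) x0 by (auto simp: v_def)
  show ?thesis
  proof
    show "0 < norm v" "z \<in> Z" using v z by auto
    show "dist c z = norm v" using zc by (metis dist_commute dist_norm)
    fix y assume y: "y \<in> Z" "dist c y \<le> norm v"
    define w where "w = y - c"
    have w: "norm w \<le> norm v" using y(2) by (simp add: w_def dist_norm norm_minus_commute)
    have "2 * norm v = dist x0 z" by (simp add: v_def dist_norm norm_minus_commute)
    also have "\<dots> \<le> dist x0 y" by (rule z(2)) fact
    also have "dist x0 y = norm (w + v)" by (simp add: w_def c_def dist_norm norm_minus_commute)
    finally have "(2 * norm v)\<^sup>2 \<le> (norm (w + v))\<^sup>2" by (intro power_mono) auto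
    moreover have "(norm w)\<^sup>2 \<le> (norm v)\<^sup>2" using w by (intro power_mono) auto
    \<comment> \<open>Parallelogram law: |w - v|^2 = 2|w|^2 + 2|v|^2 - |w + v|^2, with |w| \<le> |v|
      and |w + v| \<ge> 2|v|.\<close>
    ultimately have "(norm (w - v))\<^sup>2 \<le> 0"
      by (simp add: power2_norm_eq_inner inner_add_left inner_add_right inner_diff_left
          inner_diff_right inner_commute power_mult_distrib)
    then have "w = v" by simp
    then have "y - c = z - c" using zc by (simp add: w_def)
    then show "y = z" by simp
  qed
qed

text \<open>Hopf's boundary point argument, carried out on energies: unless u is constant, pushing u
  down to the barrier M - \<epsilon> (exp (- \<alpha> |x - c|^2) - exp (- \<alpha> r^2)) near a touching point z
  of the set u = M would lower the energy. So u stays below the barrier, whose gradient at z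
  is nonzero.\<close>

lemma minimizer_strong_maximum_principle:
  fixes u :: "'a::euclidean_space \<Rightarrow> real"
  assumes min: "energy_minimizer G u" and G: "\<And>t. (G has_real_derivative g t) (at t)"
    and gM: "g M = 0" and g': "(g has_real_derivative g') (at M)"
    and max: "\<And>x. u x \<le> M" and x1: "u x1 = M"
  shows "u x = M"
proof (rule ccontr)
  assume ux: "u x \<noteq> M"
  have u: "C1_function u" using min by (simp add: energy_minimizer_def)
  have contG: "continuous_on UNIV G"
    using G by (intro continuous_at_imp_continuous_on) (auto intro: DERIV_isCont)
  let ?Z = "{x. u x = M}"
  have Z: "closed ?Z" "?Z \<noteq> {}" "x \<notin> ?Z"
    using C1_function_continuous[OF u, of UNIV] x1 ux by (auto intro: closed_Collect_eq)
  obtain c r z where r: "0 < r" and zZ: "z \<in> ?Z" and cz: "dist c z = r"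
    and touchZ: "\<And>y. y \<in> ?Z \<Longrightarrow> dist c y \<le> r \<Longrightarrow> y = z"
    by (rule interior_touching_ball[OF Z]) (rule that)
  have z: "u z = M" using zZ by simp
  have touch: "y = z" if "u y = M" "dist c y \<le> r" for y by (rule touchZ) (use that in simp_all)
  \<comment> \<open>As g M = 0, any number above |g'| bounds |g t| / |t - M| near M.\<close>
  define C where "C = \<bar>g'\<bar> + 1"
  have C: "0 < C" by (simp add: C_def)
  have "((\<lambda>t. \<bar>(g t - g M) / (t - M)\<bar>) \<longlongrightarrow> \<bar>g'\<bar>) (at M)"
    using g' by (intro tendsto_rabs) (simp add: has_field_derivative_iff)
  then have "\<forall>\<^sub>F t in at M. \<bar>(g t - g M) / (t - M)\<bar> < C"
    by (rule order_tendstoD) (simp add: C_def)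
  then obtain \<delta> where \<delta>: "0 < \<delta>" "\<And>t. t \<noteq> M \<Longrightarrow> dist t M < \<delta> \<Longrightarrow> \<bar>(g t - g M) / (t - M)\<bar> < C"
    unfolding eventually_at by auto
  have gbound: "\<bar>g t\<bar> \<le> C * \<bar>t - M\<bar>" if "dist t M < \<delta>" for t
  proof (cases "t = M")
    case False
    with \<delta>(2)[OF False that] show ?thesis by (simp add: gM abs_divide divide_less_eq less_imp_le)
  qed (simp add: gM)
  define N where "N = real DIM('a)"
  \<comment> \<open>Chosen to give \<alpha> r^2 - 2N = C + r^2. On the ball of radius r/2 about z
    one has |x - c| \<ge> r/2, and there -Delta \<rho> then exceeds C \<epsilon> E.\<close>
  define \<alpha> where "\<alpha> = (2 * N + C) / r\<^sup>2 + 1"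
  have N: "0 < N" by (simp add: N_def)
  have \<alpha>: "1 \<le> \<alpha>" using N C by (simp add: \<alpha>_def)
  have \<alpha>C: "C < \<alpha> * (\<alpha> * r\<^sup>2 - 2 * N)"
  proof -
    have "\<alpha> * r\<^sup>2 - 2 * N = C + r\<^sup>2" using r by (simp add: \<alpha>_def field_simps)
    moreover have "C < 1 * (C + r\<^sup>2)" using r by simp
    moreover have "1 * (C + r\<^sup>2) \<le> \<alpha> * (C + r\<^sup>2)" using \<alpha> C by (intro mult_right_mono) auto
    ultimately show ?thesis by (simp only:)
  qed
  define E where "E x = exp (- \<alpha> * ((x - c) \<bullet> (x - c)))" for x
  define b where "b x = E x - exp (- \<alpha> * r\<^sup>2)" for x
  have E: "0 < E x" "E x \<le> 1" for x using \<alpha> by (simp_all add: E_def)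
  have b1: "b x \<le> E x" "b x \<le> 1" for x using E[of x] exp_ge_zero[of "- \<alpha> * r\<^sup>2"] unfolding b_def by linarith+
  have b_sign: "b x \<le> 0" if "r \<le> dist c x" for x
  proof -
    have "r\<^sup>2 \<le> (dist c x)\<^sup>2" using that r by (intro power_mono) auto
    also have "(dist c x)\<^sup>2 = (x - c) \<bullet> (x - c)"
      by (simp add: dist_norm norm_minus_commute[of c x] power2_norm_eq_inner)
    finally show ?thesis using \<alpha> by (simp add: b_def E_def)
  qed
  have bz: "b z = 0"
    using cz by (simp add: b_def E_def dist_norm norm_minus_commute[of c z] flip: power2_norm_eq_inner)
  \<comment> \<open>The part of the comparison sphere where the barrier may lie below M. It is
    compact and avoids z, the only point of the closed touching ball with u = M, so u stays below M
    by a fixed amount.\<close>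
  let ?K = "sphere z (r/2) \<inter> cball c r"
  have "\<exists>\<mu>>0. \<forall>x\<in>?K. u x \<le> M - \<mu>"
  proof (cases "?K = {}")
    case True
    then show ?thesis by (intro exI[of _ 1]) auto
  next
    case False
    have "\<exists>y\<in>?K. \<forall>x\<in>?K. u x \<le> u y"
      using False C1_function_continuous[OF u]
      by (intro continuous_attains_sup compact_Int_closed) auto
    then obtain y where y: "y \<in> ?K" "\<forall>x\<in>?K. u x \<le> u y" ..
    have "y \<noteq> z" using y(1) r by auto
    then have "u y < M" using touch[of y] max[of y] y(1) by force
    then show ?thesis using y(2) by (intro exI[of _ "M - u y"]) auto
  qed
  then obtain \<mu> where \<mu>: "0 < \<mu>" "\<And>x. x \<in> ?K \<Longrightarrow> u x \<le> M - \<mu>" by blast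
  \<comment> \<open>The bound by \<mu> keeps the barrier above u on \<open>?K\<close>; the bound by
    \<delta>/2 keeps all values between \<rho> and u, where \<rho> < u, in the range where g is
    controlled.\<close>
  define \<epsilon> where "\<epsilon> = min \<mu> (\<delta>/2)"
  have \<epsilon>: "0 < \<epsilon>" "\<epsilon> \<le> \<mu>" "\<epsilon> < \<delta>" using \<mu>(1) \<delta>(1) by (auto simp: \<epsilon>_def)
  define \<rho> where "\<rho> x = M - \<epsilon> * b x" for x
  define X where "X x = (2 * \<epsilon> * \<alpha> * E x) *\<^sub>R (x - c)" for x
  have DE: "GDERIV E x :> (- 2 * \<alpha> * E x) *\<^sub>R (x - c)" for x
    unfolding E_def gderiv_def
    by (auto intro!: derivative_eq_intros simp: inner_commute algebra_simps)
  have contE: "continuous_on UNIV E" unfolding E_def by (intro continuous_intros)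
  have D\<rho>: "GDERIV \<rho> x :> X x" for x
  proof -
    have "((\<lambda>t. M - \<epsilon> * (t - exp (- \<alpha> * r\<^sup>2))) has_real_derivative - \<epsilon>) (at (E x))"
      by (auto intro!: derivative_eq_intros)
    from GDERIV_DERIV_compose[OF DE this] show ?thesis
      by (simp add: \<rho>_def[abs_def] b_def X_def mult.assoc mult.commute mult.left_commute)
  qed
  have contX: "continuous_on UNIV X" unfolding X_def using contE by (intro continuous_intros)
  note \<rho> = C1_functionI[OF D\<rho> contX] and grad\<rho> = gradient_eq_fun[OF D\<rho> contX]
  \<comment> \<open>\<open>X\<close> is the gradient of \<rho> and \<open>Y e\<close> that of its
    component along e, so the trace \<Delta> is the Laplacian of \<rho>.\<close>
  define Y where "Y e x = (2 * \<epsilon> * \<alpha> * E x) *\<^sub>R (e - (2 * \<alpha> * ((x - c) \<bullet> e)) *\<^sub>R (x - c))" for e x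
  have DX: "GDERIV (\<lambda>x. X x \<bullet> e) x :> Y e x" for e x
  proof -
    have "GDERIV (\<lambda>x. E x * ((2 * \<epsilon> * \<alpha>) * ((x - c) \<bullet> e))) x :>
        E x *\<^sub>R ((2 * \<epsilon> * \<alpha>) *\<^sub>R e) + ((2 * \<epsilon> * \<alpha>) * ((x - c) \<bullet> e)) *\<^sub>R ((- 2 * \<alpha> * E x) *\<^sub>R (x - c))"
      by (intro GDERIV_mult DE) (auto intro!: derivative_eq_intros simp: gderiv_def inner_commute)
    moreover have "E x *\<^sub>R ((2 * \<epsilon> * \<alpha>) *\<^sub>R e) + ((2 * \<epsilon> * \<alpha>) * ((x - c) \<bullet> e)) *\<^sub>R ((- 2 * \<alpha> * E x) *\<^sub>R (x - c)) = Y e x"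
      by (simp add: Y_def scaleR_right_diff_distrib algebra_simps)
    moreover have "(\<lambda>x. E x * ((2 * \<epsilon> * \<alpha>) * ((x - c) \<bullet> e))) = (\<lambda>x. X x \<bullet> e)"
      by (simp add: X_def fun_eq_iff algebra_simps)
    ultimately show ?thesis by simp
  qed
  have contY: "continuous_on UNIV (Y e)" for e
    unfolding Y_def using contE by (intro continuous_intros)
  note XC1 = C1_functionI[OF DX contY] and gradX = gradient_eq_fun[OF DX contY]
  define \<Delta> where "\<Delta> x = (\<Sum>e\<in>Basis. Y e x \<bullet> e)" for x
  have \<Delta>: "\<Delta> x = 2 * \<epsilon> * \<alpha> * E x * (N - 2 * \<alpha> * ((x - c) \<bullet> (x - c)))" for x
  proof -
    have "\<Delta> x = (\<Sum>e\<in>Basis. 2 * \<epsilon> * \<alpha> * E x * (1 - 2 * \<alpha> * (((x - c) \<bullet> e) * ((x - c) \<bullet> e))))"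
      unfolding \<Delta>_def Y_def by (intro sum.cong) (simp_all add: inner_diff_left inner_same_Basis mult.assoc)
    also have "\<dots> = 2 * \<epsilon> * \<alpha> * E x * (N - 2 * \<alpha> * (\<Sum>e\<in>Basis. ((x - c) \<bullet> e) * ((x - c) \<bullet> e)))"
      by (simp add: N_def sum_subtractf flip: sum_distrib_left)
    finally show ?thesis by (simp flip: euclidean_inner)
  qed
  let ?B = "ball z (r/2)"
  let ?h = "\<lambda>x. u x - \<rho> x"
  let ?S = "{x \<in> ?B. \<rho> x < u x}"
  have h: "C1_function ?h" "gradient ?h = (\<lambda>x. gradient u x - X x)"
    using C1_function_diff[OF u \<rho>] by (simp_all add: grad\<rho>)
  have on_sphere: "u x \<le> \<rho> x" if "x \<in> sphere z (r/2)" for x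
  proof (cases "dist c x \<le> r")
    case True
    then have "u x \<le> M - \<mu>" using that \<mu>(2) by simp
    moreover have "\<epsilon> * b x \<le> \<mu> * 1" using \<epsilon> b1(2)[of x] \<mu>(1) by (intro order_trans[OF mult_left_mono[of "b x" 1 \<epsilon>]]) auto
    ultimately show ?thesis by (simp add: \<rho>_def)
  next
    case False
    then have "\<epsilon> * b x \<le> 0" using b_sign[of x] \<epsilon>(1) by (simp add: mult_le_0_iff)
    then show ?thesis using max[of x] by (simp add: \<rho>_def)
  qed
  have S: "open ?S" "bounded ?S"
  proof -
    have "open {x. \<rho> x < u x}"
      using C1_function_continuous[OF u, of UNIV] C1_function_continuous[OF \<rho>, of UNIV]
      by (intro open_Collect_less)
    then have "open (?B \<inter> {x. \<rho> x < u x})" by (intro open_Int open_ball)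
    also have "?B \<inter> {x. \<rho> x < u x} = ?S" by auto
    finally show "open ?S" .
    show "bounded ?S" by (rule bounded_subset[OF bounded_ball[of z "r/2"]]) auto
  qed
  define d where "d x = energy_density G u x - energy_density G \<rho> x" for x
  \<comment> \<open>Summed over the basis, \<open>T e\<close> is the divergence of (u - \<rho>) grad
    \<rho>.\<close>
  define T where "T e x = gradient ?h x \<bullet> e * (X x \<bullet> e) + ?h x * (Y e x \<bullet> e)" for e x
  have contd: "continuous_on UNIV d"
    unfolding d_def by (intro continuous_on_diff continuous_energy_density contG u \<rho>)
  have contT: "continuous_on UNIV (T e)" for e
    unfolding T_def using C1_function_continuous_gradient[OF h(1), of UNIV]
      C1_function_continuous[OF u, of UNIV] C1_function_continuous[OF \<rho>, of UNIV] contX contY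
    by (intro continuous_intros)
  have intd: "(LINT x:?S|lebesgue. d x) \<le> 0"
    unfolding d_def using min_comparison[OF min contG \<rho>, of "r/2" z] r on_sphere by simp
  have intT: "(LINT x:?S|lebesgue. T e x) = 0" for e
    using integration_by_parts_positive_part[OF h(1) XC1, of "r/2" z e e] r on_sphere
    by (simp add: T_def gradX)
  have sint: "set_integrable lebesgue ?S f" if "continuous_on UNIV f" for f :: "'a \<Rightarrow> real"
    using that S by (intro continuous_set_integrable_lebesgue) auto
  \<comment> \<open>Subtracting terms of integral 0 leaves the energy inequality intact and cancels
    the gradient of u up to a nonnegative square, which makes a pointwise sign possible.\<close>
  define k where "k x = d x - (\<Sum>e\<in>Basis. T e x)" for x
  have contk: "continuous_on UNIV k" unfolding k_def by (intro continuous_intros contd contT)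
  have intk: "(LINT x:?S|lebesgue. k x) \<le> 0"
  proof -
    have "(LINT x:?S|lebesgue. \<Sum>e\<in>Basis. T e x) = (\<Sum>e\<in>Basis. LINT x:?S|lebesgue. T e x)"
      using sint[OF contT]
      unfolding set_lebesgue_integral_def set_integrable_def scaleR_sum_right
      by (rule Bochner_Integration.integral_sum)
    moreover have "continuous_on UNIV (\<lambda>x. \<Sum>e\<in>Basis. T e x)" by (intro continuous_on_sum contT)
    ultimately have "(LINT x:?S|lebesgue. k x) = (LINT x:?S|lebesgue. d x)"
      unfolding k_def using set_integral_diff(2)[OF sint[OF contd] sint]
      by (simp only: intT sum.neutral_const diff_zero)
    then show ?thesis using intd by simp
  qed
  have kpos: "0 < k x" if "x \<in> ?S" for x
  proof -
    have x: "dist z x < r/2" "\<rho> x < u x" using that by auto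
    have T_sum: "(\<Sum>e\<in>Basis. T e x) = (gradient u x - X x) \<bullet> X x + ?h x * \<Delta> x"
      unfolding T_def h(2) \<Delta>_def sum.distrib sum_distrib_left
      by (subst euclidean_inner[of "gradient u x - X x" "X x"]) simp
    \<comment> \<open>Convexity: |p|^2/2 - |q|^2/2 = (p - q) . q + |p - q|^2/2, with p and q the
      gradients of u and \<rho>.\<close>
    have "0 \<le> (norm (gradient u x - X x))\<^sup>2" by simp
    then have d_ge: "d x \<ge> (gradient u x - X x) \<bullet> X x + G (u x) - G (\<rho> x)"
      by (simp add: d_def grad\<rho> power2_norm_eq_inner inner_diff_left inner_diff_right inner_commute algebra_simps)
    have \<epsilon>b: "\<epsilon> * b x \<le> \<epsilon> * E x" "\<epsilon> * b x \<le> \<epsilon>" using b1[of x] \<epsilon>(1) by simp_all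
    obtain t where t: "\<rho> x < t" "t < u x" "G (u x) - G (\<rho> x) = (u x - \<rho> x) * g t"
      using MVT2[OF x(2), of G g] G by blast
    have tM: "\<bar>t - M\<bar> \<le> \<epsilon> * b x" using t(1,2) max[of x] by (simp add: \<rho>_def)
    then have "dist t M < \<delta>" using \<epsilon>b \<epsilon>(3) by (simp add: dist_real_def)
    then have "\<bar>g t\<bar> \<le> C * \<bar>t - M\<bar>" by (rule gbound)
    also have "\<dots> \<le> C * (\<epsilon> * E x)" using tM \<epsilon>b C by (intro mult_left_mono) auto
    finally have gt: "- (C * (\<epsilon> * E x)) \<le> g t" by linarith
    have "r/2 \<le> dist c x" using x(1) cz dist_triangle[of c z x] by (simp add: dist_commute)
    then have "(r/2)\<^sup>2 \<le> (dist c x)\<^sup>2" using r by (intro power_mono) auto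
    also have "(dist c x)\<^sup>2 = (x - c) \<bullet> (x - c)"
      by (simp add: dist_norm norm_minus_commute[of c x] power2_norm_eq_inner)
    finally have "r\<^sup>2 \<le> 4 * ((x - c) \<bullet> (x - c))" by (simp add: power_divide)
    then have "\<alpha> * (\<alpha> * r\<^sup>2 - 2 * N) \<le> \<alpha> * (\<alpha> * (4 * ((x - c) \<bullet> (x - c))) - 2 * N)"
      using \<alpha> by (intro mult_left_mono diff_right_mono) auto
    with \<alpha>C have "C < \<alpha> * (\<alpha> * (4 * ((x - c) \<bullet> (x - c))) - 2 * N)" by linarith
    then have "\<epsilon> * E x * C < \<epsilon> * E x * (\<alpha> * (\<alpha> * (4 * ((x - c) \<bullet> (x - c))) - 2 * N))"
      using \<epsilon>(1) E by (intro mult_strict_left_mono) auto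
    also have "\<dots> = - \<Delta> x" unfolding \<Delta> by (simp add: algebra_simps)
    finally have "0 < g t - \<Delta> x" using gt by (simp add: algebra_simps)
    then have "0 < (u x - \<rho> x) * (g t - \<Delta> x)" using x(2) by simp
    then show ?thesis unfolding k_def T_sum using d_ge t(3) by (simp add: algebra_simps)
  qed
  have S_empty: "?S = {}"
  proof (rule ccontr)
    assume "?S \<noteq> {}"
    then obtain x where x: "x \<in> ?S" by blast
    then have "k x = 0"
      using set_integral_nonpos_imp_zero[OF contk S less_imp_le[OF kpos] intk] by blast
    then show False using kpos[OF x] by simp
  qed
  \<comment> \<open>Now u \<le> \<rho> near z with equality at z, so the gradients coincide; that of
    u is 0 at its maximum, that of the barrier is not.\<close>
  have "gradient u z - X z = 0"
  proof (rule GDERIV_at_local_max)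
    show "GDERIV ?h z :> gradient u z - X z" using C1_function_GDERIV[OF h(1), of z] by (simp add: h(2))
    show "?h y \<le> ?h z" if "y \<in> ?B" for y
      using S_empty that z bz by (force simp: \<rho>_def)
  qed (use r in auto)
  moreover have "gradient u z = 0"
    by (rule GDERIV_at_local_max[OF C1_function_GDERIV[OF u], of UNIV]) (use max z in auto)
  ultimately have "X z = 0" by simp
  moreover have "z \<noteq> c" using cz r by auto
  ultimately show False using E(1)[of z] \<epsilon>(1) \<alpha> by (simp add: X_def)
qed

section \<open>Conclusion: the limit bounds u from both sides\<close>

lemma minimizer_le_limit:
  fixes u :: "'a::euclidean_space \<Rightarrow> real"
  assumes min: "energy_minimizer G u" and G: "\<And>t. (G has_real_derivative g t) (at t)"
    and g: "\<And>t. g differentiable (at t)" and lim: "(u \<longlongrightarrow> a) at_infinity"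
  shows "u x \<le> a"
proof (rule ccontr)
  assume "\<not> u x \<le> a"
  have u: "C1_function u" using min by (simp add: energy_minimizer_def)
  have contG: "continuous_on UNIV G"
    using G by (intro continuous_at_imp_continuous_on) (auto intro: DERIV_isCont)
  obtain x0 where x0: "a < u x0" "\<And>y. u y \<le> u x0"
    using maximum_above_limit[OF C1_function_continuous[OF u] lim, of x] \<open>\<not> u x \<le> a\<close> by auto
  define M where "M = u x0"
  have aM: "a < M" and max: "\<And>y. u y \<le> M" using x0 by (auto simp: M_def)
  have below: "G M \<le> G s" if "a < s" "s \<le> M" for s
    by (rule minimizer_potential_le_below_max[OF min contG lim max M_def[symmetric] that])
  \<comment> \<open>Levels s > a only are covered so far; continuity adds a itself. This endpoint
    links the two ranges: G M \<le> G a \<le> G s for every s > M.\<close>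
  have "G M \<le> G a"
  proof (rule tendsto_lowerbound)
    have "isCont G a" using G DERIV_isCont by blast
    then show "(G \<longlongrightarrow> G a) (at_right a)" by (simp add: isCont_def filterlim_at_split)
    have "\<forall>\<^sub>F s in at_right a. s \<in> {a<..<M}" by (rule eventually_at_right_real) fact
    then show "\<forall>\<^sub>F s in at_right a. G M \<le> G s" by eventually_elim (use below in auto)
  qed simp
  then have above: "G M \<le> G s" if "M < s" for s
  proof -
    have "G a \<le> G s"
      by (rule minimizer_potential_ge_above_max[OF min contG lim le_less_trans[OF max that]])
    with \<open>G M \<le> G a\<close> show ?thesis by simp
  qed
  have "g M = 0"
  proof (rule DERIV_local_min[OF G])
    show "0 < M - a" using aM by simp
    show "\<forall>y. \<bar>M - y\<bar> < M - a \<longrightarrow> G M \<le> G y"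
    proof (intro allI impI)
      fix y assume "\<bar>M - y\<bar> < M - a"
      then show "G M \<le> G y" using below[of y] above[of y] by (cases "y \<le> M") auto
    qed
  qed
  moreover obtain g' where "(g has_real_derivative g') (at M)"
    using g[of M] by (auto simp: real_differentiable_def)
  ultimately have const: "u y = M" for y
    using minimizer_strong_maximum_principle[OF min G _ _ max M_def[symmetric]] by blast
  have "\<forall>\<^sub>F y in at_infinity. u y < M" using lim aM by (rule order_tendstoD)
  then have "\<forall>\<^sub>F y in (at_infinity :: 'a filter). False" by (simp add: const)
  then show False by (simp add: trivial_limit_def[symmetric] trivial_limit_at_infinity)
qed

theorem theorem1p2:
  fixes f :: "real \<Rightarrow> real"
  assumes "f C1_differentiable_on UNIV"
  shows "\<not> (\<exists>u :: real ^ 'n \<Rightarrow> real. global_minimizer f u \<and> \<not> u constant_on UNIV \<and>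
             (\<exists>u_inf :: real. (u \<longlongrightarrow> u_inf) at_infinity))"
proof
  assume "\<exists>u :: real ^ 'n \<Rightarrow> real. global_minimizer f u \<and> \<not> u constant_on UNIV \<and>
             (\<exists>u_inf :: real. (u \<longlongrightarrow> u_inf) at_infinity)"
  then obtain u :: "real ^ 'n \<Rightarrow> real" and a where u: "global_minimizer f u" "\<not> u constant_on UNIV"
    and lim: "(u \<longlongrightarrow> a) at_infinity" by blast
  obtain G where G: "\<And>t. (G has_real_derivative - f t) (at t)" and min: "energy_minimizer G u"
    using u(1) unfolding global_minimizer_def energy_minimizer_def by blast
  have f: "f differentiable (at t)" for t
    using assms by (auto simp: C1_differentiable_on_def has_vector_derivative_def differentiable_def)
  have "u x \<le> a" for x
    using f by (intro minimizer_le_limit[OF min G _ lim]) (rule differentiable_minus)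
  \<comment> \<open>The reflected potential G(-t) has derivative f(-t), which is again
    differentiable, so the upper bound applies to -u with limit -a.\<close>
  moreover have "- u x \<le> - a" for x
  proof (rule minimizer_le_limit[OF energy_minimizer_reflect[OF min] _ _ tendsto_minus[OF lim]])
    fix t
    have neg: "((\<lambda>t. - t) has_real_derivative - 1) (at t)" by (auto intro!: derivative_eq_intros)
    show "((\<lambda>t. G (- t)) has_real_derivative f (- t)) (at t)"
      using DERIV_chain2[OF G neg] by simp
    obtain D where "(f has_real_derivative D) (at (- t))"
      using f[of "- t"] by (auto simp: real_differentiable_def)
    from DERIV_chain2[OF this neg] show "(\<lambda>t. f (- t)) differentiable (at t)"
      unfolding real_differentiable_def ..
  qed
  ultimately have "u x = a" for x by (simp add: order_antisym)
  then show False using u(2) by (auto simp: constant_on_def)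
qed

end
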